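(* Let $p>1$ and $a,b\in I$ with $a<b$. Assume the $q_{ij}$ are continuously differentiable with respect to $x$ in $[a,b]\times\mathbb R^d$, let $\beta_i=b_i-\sum_{j=1}^dD_jq_{ij}$, and assume there is a constant $K_p'>0$ with $\frac{|\beta(t,x)|^2}{4(p-1)\eta(t,x)}-c(t,x)\le K_p'$ for $(t,x)\in[a,b]\times\mathbb R^d$. Then for all $a\le s\le t\le b$, $G(t,s)$ leaves $L^p(\mathbb R^d)$ invariant, i.e. for every $f\in L^p(\mathbb R^d)$ the function $(G(t,s)f)(x)=\int_{\mathbb R^d}g(t,s,x,y)f(y)dy$ (for $t>s$) belongs to $L^p(\mathbb R^d)$, and $\|G(t,s)f\|_{L^p(\mathbb R^d)}\le e^{K_p'(t-s)}\|f\|_{L^p(\mathbb R^d)}$.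
   Context: Let $d\ge1$, $\alpha\in(0,1)$, $I\subseteq\mathbb R$ either $\mathbb R$ or a right half-line. For $t\in I$, $(\mathcal A(t)\psi)(x)=\sum_{i,j}q_{ij}(t,x)D_{ij}\psi(x)+\sum_ib_i(t,x)D_i\psi(x)-c(t,x)\psi(x)$, with: $q_{ij},b_i,c\in C^{\alpha/2,\alpha}_{\rm loc}(I\times\mathbb R^d)$; $\inf c>-\infty$; $Q=(q_{ij})$ symmetric and there is $\eta:I\times\mathbb R^d\to\mathbb R$ with $\inf\eta>0$ and $\langle Q(t,x)\xi,\xi\rangle\ge\eta(t,x)|\xi|^2$ for all $\xi\in\mathbb R^d$; for every bounded interval $J\subset I$ there are positive $\phi_J\in C^2(\mathbb R^d)$ with $\phi_J\to+\infty$ at infinity and $\lambda_J$ with $\mathcal A(t)\phi_J\le\lambda_J\phi_J$ on $J\times\mathbb R^d$. $G(t,s)$ is the evolution operator on $C_b(\mathbb R^d)$: $G(t,s)f=u_f(t,\cdot)$ for $t>s$, $u_f$ the unique solution (bounded on strips, in $C([s,\infty)\times\mathbb R^d)\cap C^{1+\alpha/2,2+\alpha}_{\rm loc}((s,\infty)\times\mathbb R^d)$) of $D_tu=\mathcal A(t)u$, $u(s)=f$; $G(t,t)=\mathrm{id}$. Its Green function $g$ is positive with $(G(t,s)f)(x)=\int g(t,s,x,y)f(y)dy$ for $f\in C_b(\mathbb R^d)$. *)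

theory Defs
  imports "HOL-Analysis.Analysis"
begin

text \<open>Points of R^d are vectors of type real^'d (d = CARD('d) \<ge> 1).
  Coefficients: Q t x i j = q_ij(t,x), B t x i = b_i(t,x), c t x.\<close>

definition has_partial :: "(real^'d \<Rightarrow> real) \<Rightarrow> 'd \<Rightarrow> real^'d \<Rightarrow> real \<Rightarrow> bool" where
  "has_partial \<phi> i x D \<longleftrightarrow> ((\<lambda>h. \<phi> (x + h *\<^sub>R axis i 1)) has_real_derivative D) (at 0)"

definition holder_loc :: "real \<Rightarrow> (real \<times> (real^'d)) set \<Rightarrow> (real \<Rightarrow> real^'d \<Rightarrow> real) \<Rightarrow> bool" where
  "holder_loc \<alpha> S F \<longleftrightarrow>
     (\<forall>K. compact K \<and> K \<subseteq> S \<longrightarrow>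
        (\<exists>C. \<forall>t x s y. (t, x) \<in> K \<and> (s, y) \<in> K \<longrightarrow>
            \<bar>F t x - F s y\<bar> \<le> C * (\<bar>t - s\<bar> powr (\<alpha>/2) + dist x y powr \<alpha>)))"

definition Aop :: "(real \<Rightarrow> real^'d \<Rightarrow> 'd \<Rightarrow> 'd \<Rightarrow> real) \<Rightarrow> (real \<Rightarrow> real^'d \<Rightarrow> 'd \<Rightarrow> real)
     \<Rightarrow> (real \<Rightarrow> real^'d \<Rightarrow> real) \<Rightarrow> real \<Rightarrow> real^'d \<Rightarrow> real \<Rightarrow> ('d \<Rightarrow> real) \<Rightarrow> ('d \<Rightarrow> 'd \<Rightarrow> real) \<Rightarrow> real" where
  "Aop Q B c t x u Du D2u =
     (\<Sum>i\<in>UNIV. \<Sum>j\<in>UNIV. Q t x i j * D2u i j) + (\<Sum>i\<in>UNIV. B t x i * Du i) - c t x * u"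

definition C2_with :: "(real^'d \<Rightarrow> real) \<Rightarrow> ('d \<Rightarrow> real^'d \<Rightarrow> real) \<Rightarrow> ('d \<Rightarrow> 'd \<Rightarrow> real^'d \<Rightarrow> real) \<Rightarrow> bool" where
  "C2_with \<phi> D\<phi> D2\<phi> \<longleftrightarrow>
     (\<forall>i x. has_partial \<phi> i x (D\<phi> i x)) \<and>
     (\<forall>i j x. has_partial (D\<phi> j) i x (D2\<phi> i j x)) \<and>
     continuous_on UNIV \<phi> \<and> (\<forall>i. continuous_on UNIV (D\<phi> i)) \<and>
     (\<forall>i j. continuous_on UNIV (D2\<phi> i j))"

definition standing_assms ::
  "real \<Rightarrow> real set \<Rightarrow> (real \<Rightarrow> real^'d \<Rightarrow> 'd \<Rightarrow> 'd \<Rightarrow> real) \<Rightarrow> (real \<Rightarrow> real^'d \<Rightarrow> 'd \<Rightarrow> real)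
     \<Rightarrow> (real \<Rightarrow> real^'d \<Rightarrow> real) \<Rightarrow> (real \<Rightarrow> real^'d \<Rightarrow> real) \<Rightarrow> bool" where
  "standing_assms \<alpha> I Q B c \<eta> \<longleftrightarrow>
     0 < \<alpha> \<and> \<alpha> < 1 \<and>
     (I = UNIV \<or> (\<exists>t0. I = {t0..}) \<or> (\<exists>t0. I = {t0<..})) \<and>
     (\<forall>i j. holder_loc \<alpha> (I \<times> UNIV) (\<lambda>t x. Q t x i j)) \<and>
     (\<forall>i. holder_loc \<alpha> (I \<times> UNIV) (\<lambda>t x. B t x i)) \<and>
     holder_loc \<alpha> (I \<times> UNIV) c \<and>
     (\<exists>c0. \<forall>t\<in>I. \<forall>x. c0 \<le> c t x) \<and>
     (\<forall>t\<in>I. \<forall>x i j. Q t x i j = Q t x j i) \<and>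
     (\<exists>\<eta>0>0. \<forall>t\<in>I. \<forall>x. \<eta>0 \<le> \<eta> t x) \<and>
     (\<forall>t\<in>I. \<forall>x \<xi>. (\<Sum>i\<in>UNIV. \<Sum>j\<in>UNIV. Q t x i j * \<xi>$i * \<xi>$j) \<ge> \<eta> t x * (norm \<xi>)\<^sup>2) \<and>
     (\<forall>J. is_interval J \<and> bounded J \<and> J \<subseteq> I \<longrightarrow>
        (\<exists>\<phi> D\<phi> D2\<phi> lam. C2_with \<phi> D\<phi> D2\<phi> \<and> (\<forall>x. 0 < \<phi> x) \<and>
            filterlim \<phi> at_top at_infinity \<and>
            (\<forall>t\<in>J. \<forall>x. Aop Q B c t x (\<phi> x) (\<lambda>i. D\<phi> i x) (\<lambda>i j. D2\<phi> i j x) \<le> lam * \<phi> x)))"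

definition C12_holder_loc_with :: "real \<Rightarrow> (real \<times> (real^'d)) set \<Rightarrow> (real \<Rightarrow> real^'d \<Rightarrow> real)
     \<Rightarrow> (real \<Rightarrow> real^'d \<Rightarrow> real) \<Rightarrow> ('d \<Rightarrow> real \<Rightarrow> real^'d \<Rightarrow> real) \<Rightarrow> ('d \<Rightarrow> 'd \<Rightarrow> real \<Rightarrow> real^'d \<Rightarrow> real) \<Rightarrow> bool" where
  "C12_holder_loc_with \<alpha> S u Dt Du D2u \<longleftrightarrow>
     (\<forall>(t, x)\<in>S. ((\<lambda>\<tau>. u \<tau> x) has_real_derivative Dt t x) (at t)) \<and>
     (\<forall>(t, x)\<in>S. \<forall>i. has_partial (u t) i x (Du i t x)) \<and>
     (\<forall>(t, x)\<in>S. \<forall>i j. has_partial (Du j t) i x (D2u i j t x)) \<and>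
     holder_loc \<alpha> S u \<and> holder_loc \<alpha> S Dt \<and>
     (\<forall>i. holder_loc \<alpha> S (Du i)) \<and> (\<forall>i j. holder_loc \<alpha> S (D2u i j))"

definition Cb :: "(real^'d \<Rightarrow> real) set" where
  "Cb = {f. continuous_on UNIV f \<and> bounded (range f)}"

definition cauchy_sol :: "real \<Rightarrow> (real \<Rightarrow> real^'d \<Rightarrow> 'd \<Rightarrow> 'd \<Rightarrow> real) \<Rightarrow> (real \<Rightarrow> real^'d \<Rightarrow> 'd \<Rightarrow> real)
     \<Rightarrow> (real \<Rightarrow> real^'d \<Rightarrow> real) \<Rightarrow> real \<Rightarrow> (real^'d \<Rightarrow> real) \<Rightarrow> (real \<Rightarrow> real^'d \<Rightarrow> real) \<Rightarrow> bool" where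
  "cauchy_sol \<alpha> Q B c s f u \<longleftrightarrow>
     continuous_on ({s..} \<times> UNIV) (\<lambda>(t, x). u t x) \<and>
     (\<forall>T>s. bounded ((\<lambda>(t, x). u t x) ` ({s..T} \<times> UNIV))) \<and>
     (\<exists>Dt Du D2u. C12_holder_loc_with \<alpha> ({s<..} \<times> UNIV) u Dt Du D2u \<and>
        (\<forall>t>s. \<forall>x. Dt t x = Aop Q B c t x (u t x) (\<lambda>i. Du i t x) (\<lambda>i j. D2u i j t x))) \<and>
     (\<forall>x. u s x = f x)"

definition evol :: "real \<Rightarrow> (real \<Rightarrow> real^'d \<Rightarrow> 'd \<Rightarrow> 'd \<Rightarrow> real) \<Rightarrow> (real \<Rightarrow> real^'d \<Rightarrow> 'd \<Rightarrow> real)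
     \<Rightarrow> (real \<Rightarrow> real^'d \<Rightarrow> real) \<Rightarrow> real \<Rightarrow> real \<Rightarrow> (real^'d \<Rightarrow> real) \<Rightarrow> real^'d \<Rightarrow> real" where
  "evol \<alpha> Q B c t s f =
     (if t = s then f else (THE v. \<exists>u. cauchy_sol \<alpha> Q B c s f u \<and> v = u t))"

definition green_fun :: "real \<Rightarrow> real set \<Rightarrow> (real \<Rightarrow> real^'d \<Rightarrow> 'd \<Rightarrow> 'd \<Rightarrow> real) \<Rightarrow> (real \<Rightarrow> real^'d \<Rightarrow> 'd \<Rightarrow> real)
     \<Rightarrow> (real \<Rightarrow> real^'d \<Rightarrow> real) \<Rightarrow> (real \<Rightarrow> real \<Rightarrow> real^'d \<Rightarrow> real^'d \<Rightarrow> real) \<Rightarrow> bool" where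
  "green_fun \<alpha> I Q B c g \<longleftrightarrow>
     (\<forall>s\<in>I. \<forall>t>s. \<forall>x y. 0 < g t s x y) \<and>
     (\<forall>s\<in>I. \<forall>t>s. \<forall>f\<in>Cb. \<forall>x.
        integrable lebesgue (\<lambda>y. g t s x y * f y) \<and>
        evol \<alpha> Q B c t s f x = (LINT y|lebesgue. g t s x y * f y))"

definition green_apply :: "(real \<Rightarrow> real \<Rightarrow> real^'d \<Rightarrow> real^'d \<Rightarrow> real) \<Rightarrow> real \<Rightarrow> real \<Rightarrow> (real^'d \<Rightarrow> real) \<Rightarrow> real^'d \<Rightarrow> real" where
  "green_apply g t s f x = (if t = s then f x else LINT y|lebesgue. g t s x y * f y)"

definition in_Lp :: "real \<Rightarrow> (real^'d \<Rightarrow> real) \<Rightarrow> bool" where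
  "in_Lp p f \<longleftrightarrow> f \<in> borel_measurable lebesgue \<and> integrable lebesgue (\<lambda>x. \<bar>f x\<bar> powr p)"

definition Lp_norm :: "real \<Rightarrow> (real^'d \<Rightarrow> real) \<Rightarrow> real" where
  "Lp_norm p f = (LINT x|lebesgue. \<bar>f x\<bar> powr p) powr (1 / p)"

end

theory Submission
  imports Defs
begin

text \<open>
  Let \<open>\<phi>\<close> be a Lyapunov function with rate \<open>\<lambda> \<ge> 0\<close> and \<open>u\<close> a bounded solution. Then
  \<open>w = u - \<epsilon> exp (\<lambda> (t - s)) \<phi>\<close> satisfies \<open>D\<^sub>t w \<le> A(t) w\<close> and its positive part has compact support,
  so that \<open>\<integral> w\<^sub>+\<^sup>p\<close> can be differentiated and integrated by parts although the coefficients are unbounded.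
  Ellipticity and Young's inequality give \<open>d/dt \<integral> w\<^sub>+\<^sup>p \<le> p K \<integral> w\<^sub>+\<^sup>p\<close>, and \<open>\<epsilon> \<rightarrow> 0\<close> yields
  \<open>\<integral> u\<^sub>+(t)\<^sup>p \<le> exp (p K (t - s)) \<integral> u\<^sub>+(s)\<^sup>p\<close>. Applied to differences, this estimate also gives
  uniqueness for the Cauchy problem; solvability for nonnegative data is forced by the positivity of the
  Green function.
  The bound extends from \<open>C\<^sub>b\<close> to \<open>L\<^sup>p\<close> by approximating measurable functions almost everywhere by
  continuous ones.
\<close>

section \<open>A smooth substitute for powers of the positive part\<close>

definition cutoff_powr :: "nat \<Rightarrow> real \<Rightarrow> real \<Rightarrow> real \<Rightarrow> real" where
  "cutoff_powr n q \<delta> w = max 0 (w - \<delta>) ^ n * w powr q"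

lemma cutoff_powr_eq_0:
  assumes "w \<le> \<delta>" "0 < n"
  shows "cutoff_powr n q \<delta> w = 0"
  using assms by (simp add: cutoff_powr_def max_def)

lemma continuous_on_cutoff_powr:
  assumes "0 < \<delta>" "0 < n"
  shows "continuous_on UNIV (cutoff_powr n q \<delta>)"
proof -
  have "continuous_on {..\<delta>} (cutoff_powr n q \<delta>)"
    by (rule continuous_on_eq[of _ "\<lambda>_. 0"]) (use assms in \<open>auto simp: cutoff_powr_eq_0\<close>)
  moreover have "continuous_on {\<delta>..} (cutoff_powr n q \<delta>)"
    unfolding cutoff_powr_def[abs_def] using assms by (intro continuous_intros) auto
  ultimately have "continuous_on ({..\<delta>} \<union> {\<delta>..}) (cutoff_powr n q \<delta>)"
    by (intro continuous_on_closed_Un) auto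
  also have "{..\<delta>} \<union> {\<delta>..} = UNIV" by auto
  finally show ?thesis .
qed

lemma DERIV_max_0_power:
  fixes x :: real
  assumes "2 \<le> n"
  shows "((\<lambda>x. max 0 x ^ n) has_real_derivative n * max 0 x ^ (n - 1)) (at x)"
proof (cases x "0 :: real" rule: linorder_cases)
  case less
  have "((\<lambda>x. max 0 x ^ n) has_real_derivative 0) (at x)"
    by (rule has_field_derivative_transform_within_open[of "\<lambda>_. 0" _ _ "{..<0}"])
      (use less assms in \<open>auto simp: max_def\<close>)
  then show ?thesis using less assms by (simp add: max_def zero_power)
next
  case greater
  have "((\<lambda>x. max 0 x ^ n) has_real_derivative n * x ^ (n - 1)) (at x)"
    by (rule has_field_derivative_transform_within_open[of "\<lambda>x. x ^ n" _ _ "{0<..}"])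
      (use greater in \<open>auto simp: max_def intro!: derivative_eq_intros\<close>)
  then show ?thesis using greater by (simp add: max_def)
next
  case equal
  have "((\<lambda>h. max 0 h ^ n / h) \<longlongrightarrow> 0) (at (0::real))"
  proof (rule Lim_null_comparison)
    have "\<bar>max 0 h ^ n / h\<bar> \<le> \<bar>h\<bar> ^ (n - 1)" for h :: real
      using assms by (cases n) (auto simp: max_def field_simps zero_power)
    then show "\<forall>\<^sub>F h in at 0. norm (max 0 h ^ n / h) \<le> \<bar>h\<bar> ^ (n - 1)"
      by (simp add: eventually_at_filter)
    show "((\<lambda>h. \<bar>h\<bar> ^ (n - 1)) \<longlongrightarrow> 0) (at (0::real))"
      by (rule tendsto_eq_intros refl)+ (use assms in auto)
  qed
  then show ?thesis using equal assms by (simp add: has_field_derivative_iff zero_power)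
qed

lemma DERIV_cutoff_powr:
  assumes "0 < \<delta>" "2 \<le> n"
  shows "(cutoff_powr n q \<delta> has_real_derivative
    n * cutoff_powr (n - 1) q \<delta> w + q * cutoff_powr n (q - 1) \<delta> w) (at w)"
proof (cases "w < \<delta>")
  case True
  have "(cutoff_powr n q \<delta> has_real_derivative 0) (at w)"
    by (rule has_field_derivative_transform_within_open[of "\<lambda>_. 0" _ _ "{..<\<delta>}"])
      (use True assms in \<open>auto simp: cutoff_powr_eq_0\<close>)
  then show ?thesis using True assms by (simp add: cutoff_powr_eq_0)
next
  case False
  with assms have "0 < w" by simp
  have "((\<lambda>w. max 0 (w - \<delta>) ^ n) has_real_derivative n * max 0 (w - \<delta>) ^ (n - 1)) (at w)"
    using DERIV_shift[of "\<lambda>x. max 0 x ^ n" _ w "- \<delta>"] DERIV_max_0_power[OF assms(2), of "w - \<delta>"] by simp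
  from DERIV_mult[OF this has_real_derivative_powr[OF \<open>0 < w\<close>, of q]]
  show ?thesis by (simp add: cutoff_powr_def[abs_def] mult_ac add.commute)
qed

text \<open>For \<open>p < 2\<close> the function \<open>w\<^sub>+\<^sup>p\<close> is not \<open>C\<^sup>2\<close>, so it is replaced by \<open>w\<^sup>p (1 - \<delta>/w)\<^sub>+\<^sup>3\<close>.
  The third power makes this \<open>C\<^sup>2\<close> and keeps the inequality \<open>w h' \<ge> (p - 1) h\<close> for the derivative \<open>h\<close>.\<close>

definition smooth_powr :: "real \<Rightarrow> real \<Rightarrow> real \<Rightarrow> real" where
  "smooth_powr p \<delta> w = cutoff_powr 3 (p - 3) \<delta> w"

definition smooth_powr' :: "real \<Rightarrow> real \<Rightarrow> real \<Rightarrow> real" where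
  "smooth_powr' p \<delta> w = 3 * cutoff_powr 2 (p - 3) \<delta> w + (p - 3) * cutoff_powr 3 (p - 4) \<delta> w"

definition smooth_powr'' :: "real \<Rightarrow> real \<Rightarrow> real \<Rightarrow> real" where
  "smooth_powr'' p \<delta> w = 6 * cutoff_powr 1 (p - 3) \<delta> w + 6 * (p - 3) * cutoff_powr 2 (p - 4) \<delta> w
     + (p - 3) * (p - 4) * cutoff_powr 3 (p - 5) \<delta> w"

lemma smooth_powr_eq_0:
  assumes "w \<le> \<delta>"
  shows "smooth_powr p \<delta> w = 0" "smooth_powr' p \<delta> w = 0" "smooth_powr'' p \<delta> w = 0"
  using assms by (simp_all add: smooth_powr_def smooth_powr'_def smooth_powr''_def cutoff_powr_eq_0)

lemma DERIV_smooth_powr: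
  assumes "0 < \<delta>"
  shows "(smooth_powr p \<delta> has_real_derivative smooth_powr' p \<delta> w) (at w)"
  using DERIV_cutoff_powr[OF assms, of 3 "p - 3" w]
  by (simp add: smooth_powr_def[abs_def] smooth_powr'_def)

lemma DERIV_smooth_powr':
  assumes "0 < \<delta>"
  shows "(smooth_powr' p \<delta> has_real_derivative smooth_powr'' p \<delta> w) (at w)"
proof -
  have "(smooth_powr' p \<delta> has_real_derivative
      3 * (2 * cutoff_powr 1 (p - 3) \<delta> w + (p - 3) * cutoff_powr 2 (p - 4) \<delta> w)
      + (p - 3) * (3 * cutoff_powr 2 (p - 4) \<delta> w + (p - 4) * cutoff_powr 3 (p - 5) \<delta> w)) (at w)"
    unfolding smooth_powr'_def[abs_def]
    using DERIV_cutoff_powr[OF assms, of 2 "p - 3" w] DERIV_cutoff_powr[OF assms, of 3 "p - 4" w]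
    by (intro DERIV_add DERIV_cmult) simp_all
  then show ?thesis by (simp add: smooth_powr''_def algebra_simps)
qed

lemma continuous_on_smooth_powr [continuous_intros]:
  assumes "0 < \<delta>" "continuous_on S f"
  shows "continuous_on S (\<lambda>x. smooth_powr p \<delta> (f x))"
    and "continuous_on S (\<lambda>x. smooth_powr' p \<delta> (f x))"
    and "continuous_on S (\<lambda>x. smooth_powr'' p \<delta> (f x))"
  unfolding smooth_powr_def smooth_powr'_def smooth_powr''_def using assms
  by (auto intro!: continuous_intros continuous_on_compose2[OF continuous_on_cutoff_powr _ subset_UNIV])

lemma smooth_powr'_nonneg:
  assumes "0 < \<delta>" "1 < p"
  shows "0 \<le> smooth_powr' p \<delta> w"
proof (cases "w \<le> \<delta>")
  case False
  with assms have "smooth_powr' p \<delta> w = w powr (p - 4) * (w - \<delta>)\<^sup>2 * (3 * w + (p - 3) * (w - \<delta>))"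
    by (simp add: smooth_powr'_def cutoff_powr_def powr_diff field_simps eval_nat_numeral)
  moreover have "0 \<le> (p - 1) * (w - \<delta>)" using assms False by simp
  then have "0 \<le> 3 * w + (p - 3) * (w - \<delta>)" using assms False by (simp add: algebra_simps)
  ultimately show ?thesis by simp
qed (simp add: smooth_powr_eq_0)

lemma smooth_powr''_ge:
  assumes "0 < \<delta>" "1 < p"
  shows "(p - 1) * smooth_powr' p \<delta> w \<le> w * smooth_powr'' p \<delta> w"
proof (cases "w \<le> \<delta>")
  case False
  with assms have "w * smooth_powr'' p \<delta> w - (p - 1) * smooth_powr' p \<delta> w
      = w powr (p - 4) * (w - \<delta>) * (3 * \<delta>) * (2 * w + (p - 3) * (w - \<delta>))"
    by (simp add: smooth_powr'_def smooth_powr''_def cutoff_powr_def powr_diff field_simps eval_nat_numeral)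
  moreover have "0 \<le> (p - 1) * (w - \<delta>)" using assms False by simp
  then have "0 \<le> 2 * w + (p - 3) * (w - \<delta>)" using assms False by (simp add: algebra_simps)
  ultimately have "0 \<le> w * smooth_powr'' p \<delta> w - (p - 1) * smooth_powr' p \<delta> w"
    using assms False by simp
  then show ?thesis by simp
qed (simp add: smooth_powr_eq_0)

lemma mult_smooth_powr'_le:
  assumes "0 < \<delta>" "1 < p" "w \<le> M"
  shows "w * smooth_powr' p \<delta> w \<le> p * smooth_powr p \<delta> w + 3 * \<delta> * M powr (p - 1)"
proof (cases "w \<le> \<delta>")
  case False
  with assms have "0 < w" by simp
  have "w * smooth_powr' p \<delta> w - p * smooth_powr p \<delta> w = 3 * \<delta> * ((w - \<delta>)\<^sup>2 * w powr (p - 3))"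
    using assms False
    by (simp add: smooth_powr'_def smooth_powr_def cutoff_powr_def powr_diff field_simps eval_nat_numeral)
  also have "(w - \<delta>)\<^sup>2 * w powr (p - 3) \<le> w\<^sup>2 * w powr (p - 3)"
    using assms False by (intro mult_right_mono power_mono) auto
  also have "w\<^sup>2 * w powr (p - 3) = w powr (p - 1)"
    using \<open>0 < w\<close> by (simp add: powr_diff field_simps eval_nat_numeral)
  also have "\<dots> \<le> M powr (p - 1)"
    using assms \<open>0 < w\<close> by (intro powr_mono2) auto
  finally show ?thesis using assms(1) by simp
qed (use assms in \<open>simp add: smooth_powr_eq_0\<close>)

lemma smooth_powr_le:
  assumes "0 < \<delta>"
  shows "smooth_powr p \<delta> w \<le> max 0 w powr p"
proof (cases "w \<le> \<delta>")
  case False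
  have "smooth_powr p \<delta> w \<le> w ^ 3 * w powr (p - 3)"
    unfolding smooth_powr_def cutoff_powr_def using False assms by (intro mult_right_mono power_mono) auto
  also have "\<dots> = w powr p" using False assms by (simp add: powr_diff)
  finally show ?thesis using False assms by simp
qed (simp add: smooth_powr_eq_0)

lemma max_0_powr_le_smooth_powr:
  assumes "0 < \<delta>" "1 < p" "w \<le> M"
  shows "max 0 w powr p \<le> smooth_powr p \<delta> w + 3 * \<delta> * M powr (p - 1)"
proof (cases "w \<le> \<delta>")
  case True
  have "max 0 w powr p = max 0 w * max 0 w powr (p - 1)"
    by (simp add: powr_diff)
  also have "\<dots> \<le> \<delta> * M powr (p - 1)"
    using assms True by (cases "0 < w") (auto intro!: mult_mono powr_mono2)
  also have "\<dots> \<le> 3 * \<delta> * M powr (p - 1)"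
    using assms by (intro mult_right_mono) auto
  finally show ?thesis using True by (simp add: smooth_powr_eq_0)
next
  case False
  with assms have "0 < w" by simp
  have "w powr p - smooth_powr p \<delta> w = (w ^ 3 - (w - \<delta>) ^ 3) * w powr (p - 3)"
    using \<open>0 < w\<close> False by (simp add: smooth_powr_def cutoff_powr_def powr_diff field_simps)
  also have "w ^ 3 - (w - \<delta>) ^ 3 = 3 * \<delta> * w\<^sup>2 - \<delta>\<^sup>2 * (3 * w - \<delta>)"
    by (simp add: algebra_simps eval_nat_numeral)
  also have "(\<dots>) * w powr (p - 3) \<le> 3 * \<delta> * w\<^sup>2 * w powr (p - 3)"
    using False \<open>0 < w\<close> by (intro mult_right_mono) auto
  also have "\<dots> = 3 * \<delta> * w powr (p - 1)"
    using \<open>0 < w\<close> by (simp add: powr_diff field_simps eval_nat_numeral)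
  also have "\<dots> \<le> 3 * \<delta> * M powr (p - 1)"
    using assms \<open>0 < w\<close> by (intro mult_left_mono powr_mono2) auto
  finally show ?thesis using \<open>0 < w\<close> by simp
qed

section \<open>Integrals of \<open>p\<close>-th powers\<close>

definition Lp_integral :: "real \<Rightarrow> ('a::euclidean_space \<Rightarrow> real) \<Rightarrow> ennreal" where
  "Lp_integral p f = (\<integral>\<^sup>+x. ennreal (\<bar>f x\<bar> powr p) \<partial>lebesgue)"

lemma borel_measurable_lebesgue_continuous:
  fixes f :: "'a::euclidean_space \<Rightarrow> real"
  assumes "continuous_on UNIV f"
  shows "f \<in> borel_measurable lebesgue"
  using assms by (intro measurable_completion) (simp add: borel_measurable_continuous_onI)

lemma Lp_integral_mono:
  assumes "0 \<le> p" "\<And>x. \<bar>f x\<bar> \<le> \<bar>h x\<bar>"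
  shows "Lp_integral p f \<le> Lp_integral p h"
  unfolding Lp_integral_def using assms by (intro nn_integral_mono ennreal_leI powr_mono2) auto

lemma Lp_integral_dominated_convergence:
  assumes "0 < p" and [measurable]: "\<And>n. v n \<in> borel_measurable lebesgue" "f \<in> borel_measurable lebesgue"
      "h \<in> borel_measurable lebesgue"
    and lim: "AE x in lebesgue. (\<lambda>n. v n x) \<longlonglongrightarrow> f x"
    and dom: "\<And>n x. \<bar>v n x\<bar> \<le> \<bar>h x\<bar>" "Lp_integral p h < \<infinity>"
  shows "(\<lambda>n. Lp_integral p (v n)) \<longlonglongrightarrow> Lp_integral p f"
  unfolding Lp_integral_def
proof (rule nn_integral_dominated_convergence)
  show "AE x in lebesgue. ennreal (\<bar>v n x\<bar> powr p) \<le> ennreal (\<bar>h x\<bar> powr p)" for n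
    using assms(1) dom(1) by (intro always_eventually allI ennreal_leI powr_mono2) auto
  show "AE x in lebesgue. (\<lambda>n. ennreal (\<bar>v n x\<bar> powr p)) \<longlonglongrightarrow> ennreal (\<bar>f x\<bar> powr p)"
    using lim by eventually_elim (use assms(1) in \<open>auto intro!: tendsto_intros tendsto_powr'\<close>)
qed (use dom(2) in \<open>auto simp: Lp_integral_def\<close>)

lemma Lp_integral_Fatou:
  assumes "0 < p" and [measurable]: "\<And>n. v n \<in> borel_measurable lebesgue"
    and lim: "AE x in lebesgue. (\<lambda>n. v n x) \<longlonglongrightarrow> f x"
    and bound: "\<And>n. Lp_integral p (v n) \<le> b n" "b \<longlonglongrightarrow> S"
  shows "Lp_integral p f \<le> S"
proof -
  have "Lp_integral p f = (\<integral>\<^sup>+x. liminf (\<lambda>n. ennreal (\<bar>v n x\<bar> powr p)) \<partial>lebesgue)"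
    unfolding Lp_integral_def
  proof (rule nn_integral_cong_AE, rule eventually_mono[OF lim])
    fix x assume "(\<lambda>n. v n x) \<longlonglongrightarrow> f x"
    then have "(\<lambda>n. ennreal (\<bar>v n x\<bar> powr p)) \<longlonglongrightarrow> ennreal (\<bar>f x\<bar> powr p)"
      using assms(1) by (auto intro!: tendsto_intros tendsto_powr')
    then show "ennreal (\<bar>f x\<bar> powr p) = liminf (\<lambda>n. ennreal (\<bar>v n x\<bar> powr p))"
      by (intro lim_imp_Liminf[symmetric]) simp_all
  qed
  also have "\<dots> \<le> liminf (\<lambda>n. Lp_integral p (v n))"
    unfolding Lp_integral_def by (rule nn_integral_liminf) measurable
  also have "\<dots> \<le> liminf b"
    by (intro Liminf_mono always_eventually allI bound)
  also have "\<dots> = S" using bound(2) by (intro lim_imp_Liminf) auto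
  finally show ?thesis .
qed

lemma incseq_Lp_bounded_imp_AE_bdd_above:
  assumes "0 < p" and [measurable]: "\<And>n. v n \<in> borel_measurable lebesgue"
    and nonneg: "\<And>n x. 0 \<le> v n x" and mono: "\<And>x. incseq (\<lambda>n. v n x)"
    and bound: "\<And>n. Lp_integral p (v n) \<le> S" "S < \<infinity>"
  shows "AE x in lebesgue. bdd_above (range (\<lambda>n. v n x))"
proof -
  have "(\<integral>\<^sup>+x. (SUP n. ennreal (\<bar>v n x\<bar> powr p)) \<partial>lebesgue) = (SUP n. Lp_integral p (v n))"
    unfolding Lp_integral_def using assms(1) nonneg mono
    by (intro nn_integral_monotone_convergence_SUP)
      (auto simp: incseq_def le_fun_def intro!: ennreal_leI powr_mono2)
  also have "\<dots> \<le> S" by (rule SUP_least) (rule bound)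
  finally have "(\<integral>\<^sup>+x. (SUP n. ennreal (\<bar>v n x\<bar> powr p)) \<partial>lebesgue) \<noteq> \<infinity>" using bound(2) by auto
  then have "AE x in lebesgue. (SUP n. ennreal (\<bar>v n x\<bar> powr p)) \<noteq> \<infinity>"
    by (intro nn_integral_noteq_infinite) auto
  then show ?thesis
  proof eventually_elim
    case (elim x)
    then obtain r where r: "0 \<le> r" "(SUP n. ennreal (\<bar>v n x\<bar> powr p)) = ennreal r"
      by (cases "SUP n. ennreal (\<bar>v n x\<bar> powr p)") auto
    have "v n x \<le> r powr (1 / p)" for n
    proof -
      have "ennreal (\<bar>v n x\<bar> powr p) \<le> ennreal r" unfolding r(2)[symmetric] by (rule SUP_upper) simp
      then have "(v n x powr p) powr (1 / p) \<le> r powr (1 / p)"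
        using r(1) nonneg assms(1) by (intro powr_mono2) auto
      then show ?thesis using assms(1) nonneg by (simp add: powr_powr)
    qed
    then show ?case by (intro bdd_aboveI2)
  qed
qed

lemma continuous_AE_eq_0_imp_eq_0:
  fixes f :: "'a::euclidean_space \<Rightarrow> real"
  assumes "continuous_on UNIV f" "AE x in lebesgue. f x = 0"
  shows "f x = 0"
proof (rule ccontr)
  assume "f x \<noteq> 0"
  have "open {x. f x \<noteq> 0}"
    using assms(1) by (intro open_Collect_neq continuous_on_const)
  moreover from this have "negligible {x. f x \<noteq> 0}"
    using assms(2) AE_iff_null_sets[of "{x. f x \<noteq> 0}" lebesgue] by (simp add: negligible_iff_null_sets)
  ultimately show False using \<open>f x \<noteq> 0\<close> open_not_negligible by blast
qed

lemma Lp_integral_eq_0_imp_eq_0: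
  assumes "continuous_on UNIV f" "Lp_integral p f = 0"
  shows "f x = 0"
proof (rule continuous_AE_eq_0_imp_eq_0[OF assms(1)])
  have [measurable]: "f \<in> borel_measurable lebesgue"
    using assms(1) by (rule borel_measurable_lebesgue_continuous)
  have "AE x in lebesgue. ennreal (\<bar>f x\<bar> powr p) = 0"
    using assms(2) unfolding Lp_integral_def by (subst (asm) nn_integral_0_iff_AE) auto
  then show "AE x in lebesgue. f x = 0" by eventually_elim simp
qed

lemma in_Lp_iff:
  "in_Lp p f \<longleftrightarrow> f \<in> borel_measurable lebesgue \<and> Lp_integral p f < \<infinity>"
  by (auto simp: in_Lp_def Lp_integral_def integrable_iff_bounded)

lemma Lp_norm_eq:
  assumes "f \<in> borel_measurable lebesgue"
  shows "Lp_norm p f = enn2real (Lp_integral p f) powr (1 / p)"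
  using assms by (simp add: Lp_norm_def Lp_integral_def integral_eq_nn_integral)

section \<open>Positive kernel operators on \<open>L\<^sup>p\<close>\<close>

definition kernel_op :: "('a::euclidean_space \<Rightarrow> 'a \<Rightarrow> real) \<Rightarrow> ('a \<Rightarrow> real) \<Rightarrow> 'a \<Rightarrow> real" where
  "kernel_op k f x = (LINT y|lebesgue. k x y * f y)"

definition Lp_bounded_at ::
    "real \<Rightarrow> real \<Rightarrow> ('a::euclidean_space \<Rightarrow> 'a \<Rightarrow> real) \<Rightarrow> ('a \<Rightarrow> real) \<Rightarrow> bool" where
  "Lp_bounded_at p A k f \<longleftrightarrow>
     kernel_op k f \<in> borel_measurable lebesgue \<and> Lp_integral p (kernel_op k f) \<le> ennreal A * Lp_integral p f"

lemma Lp_bounded_at_limit: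
  assumes "0 < p" and bounded: "\<And>n. Lp_bounded_at p A k (F n)"
    and lim: "AE x in lebesgue. (\<lambda>n. kernel_op k (F n) x) \<longlonglongrightarrow> kernel_op k f x"
    and Lp_lim: "(\<lambda>n. Lp_integral p (F n)) \<longlonglongrightarrow> Lp_integral p f"
  shows "Lp_bounded_at p A k f"
  unfolding Lp_bounded_at_def
proof
  have measurable: "\<And>n. kernel_op k (F n) \<in> borel_measurable lebesgue"
    using bounded by (simp add: Lp_bounded_at_def)
  have "AE x in lebesgue. lim (\<lambda>n. kernel_op k (F n) x) = kernel_op k f x"
    using lim by eventually_elim (rule limI)
  moreover have "(\<lambda>x. lim (\<lambda>n. kernel_op k (F n) x)) \<in> borel_measurable lebesgue"
    by (rule borel_measurable_lim_metric) (rule measurable)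
  ultimately show "kernel_op k f \<in> borel_measurable lebesgue"
    by (rule borel_measurable_AE[rotated])
  show "Lp_integral p (kernel_op k f) \<le> ennreal A * Lp_integral p f"
    using assms(1) measurable lim
  proof (rule Lp_integral_Fatou)
    show "Lp_integral p (kernel_op k (F n)) \<le> ennreal A * Lp_integral p (F n)" for n
      using bounded by (simp add: Lp_bounded_at_def)
    show "(\<lambda>n. ennreal A * Lp_integral p (F n)) \<longlonglongrightarrow> ennreal A * Lp_integral p f"
      using Lp_lim by (intro ennreal_tendsto_cmult) auto
  qed
qed

lemma Lp_bounded_at_imp_Lp_norm_le:
  assumes "0 < p" "0 \<le> A" and bounded: "Lp_bounded_at p A k f" and f: "in_Lp p f"
  shows "in_Lp p (kernel_op k f)" "Lp_norm p (kernel_op k f) \<le> A powr (1 / p) * Lp_norm p f"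
proof -
  have kf: "kernel_op k f \<in> borel_measurable lebesgue"
    and le: "Lp_integral p (kernel_op k f) \<le> ennreal A * Lp_integral p f"
    using bounded by (simp_all add: Lp_bounded_at_def)
  have fin: "ennreal A * Lp_integral p f < \<infinity>"
    using f by (simp add: in_Lp_iff ennreal_mult_less_top)
  with le kf show "in_Lp p (kernel_op k f)" by (auto simp: in_Lp_iff)
  have "enn2real (Lp_integral p (kernel_op k f)) \<le> A * enn2real (Lp_integral p f)"
    using enn2real_mono[OF le] fin assms(2) by (simp add: enn2real_mult)
  then have "enn2real (Lp_integral p (kernel_op k f)) powr (1 / p)
      \<le> (A * enn2real (Lp_integral p f)) powr (1 / p)"
    using assms(1) by (intro powr_mono2) auto
  then show "Lp_norm p (kernel_op k f) \<le> A powr (1 / p) * Lp_norm p f"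
    using assms(2) kf f by (simp add: Lp_norm_eq in_Lp_iff powr_mult)
qed

lemma borel_measurable_lebesgue_imp_AE_limit_continuous:
  fixes f :: "'a::euclidean_space \<Rightarrow> real"
  assumes "f \<in> borel_measurable lebesgue"
  obtains G where "\<And>n. continuous_on UNIV (G n)" "AE x in lebesgue. (\<lambda>n. G n x) \<longlonglongrightarrow> f x"
proof -
  have "f measurable_on UNIV" using assms lebesgue_measurable_imp_measurable_on[of f UNIV] by simp
  then obtain N G where "negligible N" and G: "\<And>n. continuous_on UNIV (G n)"
    and lim: "\<And>x. x \<notin> N \<Longrightarrow> (\<lambda>n. G n x) \<longlonglongrightarrow> f x"
    unfolding measurable_on_def by auto
  then have "AE x in lebesgue. x \<notin> N" by (simp add: negligible_iff_null_sets AE_not_in)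
  then have "AE x in lebesgue. (\<lambda>n. G n x) \<longlonglongrightarrow> f x" by eventually_elim (rule lim)
  with G show thesis by (rule that)
qed

definition plateau :: "nat \<Rightarrow> 'a::euclidean_space \<Rightarrow> real" where
  "plateau n y = real n * max 0 (min 1 (real n + 1 - norm y))"

lemma continuous_on_plateau: "continuous_on UNIV (plateau n)"
  unfolding plateau_def[abs_def] by (intro continuous_intros)

lemma plateau_nonneg: "0 \<le> plateau n y"
  by (simp add: plateau_def)

lemma plateau_le: "plateau n y \<le> n"
  by (simp add: plateau_def mult_left_le)

lemma plateau_mono: "n \<le> m \<Longrightarrow> plateau n y \<le> plateau m y"
  unfolding plateau_def by (intro mult_mono max.mono) auto

lemma plateau_eq: "norm y \<le> n \<Longrightarrow> plateau n y = n"
  by (simp add: plateau_def)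

lemma Lp_integral_plateau_finite:
  assumes "0 \<le> p"
  shows "Lp_integral p (plateau n :: 'a::euclidean_space \<Rightarrow> real) < \<infinity>"
proof -
  let ?C = "cball (0::'a) (real n + 1)"
  have "Lp_integral p (plateau n :: 'a \<Rightarrow> real) \<le> (\<integral>\<^sup>+x. ennreal (n powr p) * indicator ?C x \<partial>lebesgue)"
    unfolding Lp_integral_def
  proof (rule nn_integral_mono)
    fix x :: 'a
    show "ennreal (\<bar>plateau n x\<bar> powr p) \<le> ennreal (n powr p) * indicator ?C x"
    proof (cases "x \<in> ?C")
      case True
      then show ?thesis
        using assms plateau_nonneg[of n x] plateau_le[of n x] by (auto intro!: ennreal_leI powr_mono2)
    qed (simp add: plateau_def)
  qed
  also have "\<dots> = ennreal (n powr p) * emeasure lebesgue ?C"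
    by (simp add: nn_integral_cmult_indicator)
  also have "\<dots> < \<infinity>"
    using emeasure_lborel_cball_finite[of "0::'a" "real n + 1"] by (simp add: ennreal_mult_less_top)
  finally show ?thesis .
qed

definition truncate_at :: "nat \<Rightarrow> ('a::euclidean_space \<Rightarrow> real) \<Rightarrow> 'a \<Rightarrow> real" where
  "truncate_at n f y = min (f y) (plateau n y)"

lemma borel_measurable_truncate_at [measurable]:
  fixes f :: "'a::euclidean_space \<Rightarrow> real"
  assumes [measurable]: "f \<in> borel_measurable lebesgue"
  shows "truncate_at n f \<in> borel_measurable lebesgue"
proof -
  have [measurable]: "plateau n \<in> borel_measurable (lebesgue :: 'a measure)"
    by (rule borel_measurable_lebesgue_continuous[OF continuous_on_plateau])
  show ?thesis unfolding truncate_at_def[abs_def] by measurable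
qed

lemma truncate_at_le: "truncate_at n f y \<le> f y" "truncate_at n f y \<le> plateau n y"
  by (simp_all add: truncate_at_def)

lemma truncate_at_nonneg: "0 \<le> f y \<Longrightarrow> 0 \<le> truncate_at n f y"
  by (simp add: truncate_at_def plateau_nonneg)

lemma incseq_truncate_at: "incseq (\<lambda>n. truncate_at n f y)"
  unfolding truncate_at_def by (intro monoI min.mono plateau_mono) auto

lemma truncate_at_tendsto: "(\<lambda>n. truncate_at n f y) \<longlonglongrightarrow> f y"
proof (rule tendsto_eventually)
  obtain m where "max (norm y) (f y) \<le> real m" using real_arch_simple by blast
  then have "truncate_at n f y = f y" if "m \<le> n" for n
    using that by (simp add: truncate_at_def plateau_eq)
  then show "\<forall>\<^sub>F n in sequentially. truncate_at n f y = f y" unfolding eventually_sequentially by blast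
qed

locale positive_kernel =
  fixes p A :: real and k :: "'a::euclidean_space \<Rightarrow> 'a \<Rightarrow> real"
  assumes p: "0 < p"
    and k_nonneg: "\<And>x y. 0 \<le> k x y"
    and k_integrable: "\<And>x. integrable lebesgue (k x)"
    and Lp_bounded_at_continuous: "\<And>f. continuous_on UNIV f \<Longrightarrow> bounded (range f) \<Longrightarrow> (\<And>y. 0 \<le> f y) \<Longrightarrow>
       Lp_bounded_at p A k f"
begin

lemma k_measurable [measurable]: "k x \<in> borel_measurable lebesgue"
  using k_integrable by auto

lemma norm_k_mult_le: "\<bar>h\<bar> \<le> M \<Longrightarrow> norm (k x y * h) \<le> M * k x y"
  using mult_left_mono[of "\<bar>h\<bar>" M "k x y"] k_nonneg[of x y] by (simp add: abs_mult mult.commute)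

lemma integrable_k_mult:
  assumes [measurable]: "f \<in> borel_measurable lebesgue" and bound: "\<And>y. \<bar>f y\<bar> \<le> M"
  shows "integrable lebesgue (\<lambda>y. k x y * f y)"
proof (rule Bochner_Integration.integrable_bound)
  show "integrable lebesgue (\<lambda>y. M * k x y)" using k_integrable by simp
  show "AE y in lebesgue. norm (k x y * f y) \<le> norm (M * k x y)"
    by (intro always_eventually allI, rule order.trans[OF norm_k_mult_le[OF bound]]) simp
qed measurable

lemma kernel_op_nonneg:
  assumes "\<And>y. 0 \<le> f y"
  shows "0 \<le> kernel_op k f x"
  unfolding kernel_op_def by (intro integral_nonneg_AE always_eventually allI mult_nonneg_nonneg k_nonneg assms)

lemma kernel_op_dominated_convergence:
  assumes [measurable]: "\<And>n. F n \<in> borel_measurable lebesgue" "f \<in> borel_measurable lebesgue"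
    and bound: "\<And>n y. \<bar>F n y\<bar> \<le> M" and lim: "AE y in lebesgue. (\<lambda>n. F n y) \<longlonglongrightarrow> f y"
  shows "(\<lambda>n. kernel_op k (F n) x) \<longlonglongrightarrow> kernel_op k f x"
  unfolding kernel_op_def
proof (rule integral_dominated_convergence)
  show "AE y in lebesgue. (\<lambda>n. k x y * F n y) \<longlonglongrightarrow> k x y * f y"
    using lim by eventually_elim (intro tendsto_intros)
  show "integrable lebesgue (\<lambda>y. M * k x y)" using k_integrable by simp
  show "AE y in lebesgue. norm (k x y * F n y) \<le> M * k x y" for n
    by (intro always_eventually allI norm_k_mult_le bound)
qed measurable

lemma Lp_bounded_at_dominated:
  assumes f[measurable]: "f \<in> borel_measurable lebesgue" and f_bounds: "\<And>y. 0 \<le> f y" "\<And>y. f y \<le> h y"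
    and h: "continuous_on UNIV h" "\<And>y. h y \<le> M" "Lp_integral p h < \<infinity>"
  shows "Lp_bounded_at p A k f"
proof -
  obtain G where G: "\<And>n. continuous_on UNIV (G n)" and G_lim: "AE x in lebesgue. (\<lambda>n. G n x) \<longlonglongrightarrow> f x"
    using borel_measurable_lebesgue_imp_AE_limit_continuous[OF f] by blast
  define F where "F n x = max 0 (min (G n x) (h x))" for n x
  have F_cont: "continuous_on UNIV (F n)" for n
    unfolding F_def[abs_def] by (intro continuous_intros G h)
  have F_nonneg: "0 \<le> F n y" and F_le: "F n y \<le> h y" for n y
    using f_bounds[of y] by (auto simp: F_def)
  have F_bound: "\<bar>F n y\<bar> \<le> M" for n y using F_nonneg[of n y] F_le[of n y] h(2)[of y] by simp
  have [measurable]: "F n \<in> borel_measurable lebesgue" "h \<in> borel_measurable lebesgue" for n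
    using F_cont h(1) by (auto intro: borel_measurable_lebesgue_continuous)
  have F_lim: "AE x in lebesgue. (\<lambda>n. F n x) \<longlonglongrightarrow> f x"
    using G_lim
  proof eventually_elim
    case (elim x)
    then have "(\<lambda>n. F n x) \<longlonglongrightarrow> max 0 (min (f x) (h x))" unfolding F_def by (intro tendsto_intros)
    then show ?case using f_bounds[of x] by simp
  qed
  show ?thesis
  proof (rule Lp_bounded_at_limit[OF p])
    show "Lp_bounded_at p A k (F n)" for n
      using F_cont F_nonneg F_bound by (intro Lp_bounded_at_continuous boundedI[of _ M]) auto
    show "AE x in lebesgue. (\<lambda>n. kernel_op k (F n) x) \<longlonglongrightarrow> kernel_op k f x"
      by (intro always_eventually allI kernel_op_dominated_convergence[OF _ f F_bound F_lim]) measurable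
    show "(\<lambda>n. Lp_integral p (F n)) \<longlonglongrightarrow> Lp_integral p f"
    proof (rule Lp_integral_dominated_convergence[OF p _ f _ F_lim _ h(3)])
      show "\<bar>F n x\<bar> \<le> \<bar>h x\<bar>" for n x using F_nonneg[of n x] F_le[of n x] by simp
    qed measurable
  qed
qed

lemma incseq_kernel_op:
  assumes "\<And>n. integrable lebesgue (\<lambda>y. k x y * F n y)" and "\<And>y. incseq (\<lambda>n. F n y)"
  shows "incseq (\<lambda>n. kernel_op k (F n) x)"
  unfolding kernel_op_def using assms(2)
  by (intro monoI integral_mono assms(1) mult_left_mono k_nonneg) (auto simp: incseq_def)

lemma kernel_op_monotone_convergence:
  assumes int: "\<And>n. integrable lebesgue (\<lambda>y. k x y * F n y)"
    and mono: "\<And>y. incseq (\<lambda>n. F n y)" and lim: "\<And>y. (\<lambda>n. F n y) \<longlonglongrightarrow> f y"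
    and bdd: "bdd_above (range (\<lambda>n. kernel_op k (F n) x))" and [measurable]: "f \<in> borel_measurable lebesgue"
  shows "integrable lebesgue (\<lambda>y. k x y * f y)"
    and "(\<lambda>n. kernel_op k (F n) x) \<longlonglongrightarrow> kernel_op k f x"
proof -
  have "AE y in lebesgue. mono (\<lambda>n. k x y * F n y)"
    using mono by (intro always_eventually allI monoI mult_left_mono k_nonneg) (auto simp: incseq_def)
  moreover have "AE y in lebesgue. (\<lambda>n. k x y * F n y) \<longlonglongrightarrow> k x y * f y"
    by (intro always_eventually allI tendsto_intros lim)
  moreover have SUP_lim: "(\<lambda>n. kernel_op k (F n) x) \<longlonglongrightarrow> (SUP n. kernel_op k (F n) x)"
    by (intro LIMSEQ_incseq_SUP bdd incseq_kernel_op int mono)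
  ultimately have "has_bochner_integral lebesgue (\<lambda>y. k x y * f y) (SUP n. kernel_op k (F n) x)"
    unfolding kernel_op_def[abs_def] by (intro has_bochner_integral_monotone_convergence) (auto intro: int)
  then show "integrable lebesgue (\<lambda>y. k x y * f y)"
    and "(\<lambda>n. kernel_op k (F n) x) \<longlonglongrightarrow> kernel_op k f x"
    using SUP_lim by (simp_all add: has_bochner_integral_iff kernel_op_def)
qed

lemma Lp_bounded_at_nonneg:
  assumes f[measurable]: "f \<in> borel_measurable lebesgue" and f_nonneg: "\<And>y. 0 \<le> f y"
    and fin: "Lp_integral p f < \<infinity>"
  shows "AE x in lebesgue. integrable lebesgue (\<lambda>y. k x y * f y)" and "Lp_bounded_at p A k f"
proof -
  let ?F = "\<lambda>n. truncate_at n f"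
  have F_nonneg: "0 \<le> ?F n y" for n y
    by (intro truncate_at_nonneg f_nonneg)
  have F_int: "integrable lebesgue (\<lambda>y. k x y * ?F n y)" for n x
    using order.trans[OF truncate_at_le(2) plateau_le] F_nonneg by (intro integrable_k_mult[of _ n]) simp_all
  have F_bounded: "Lp_bounded_at p A k (?F n)" for n
    using F_nonneg truncate_at_le(2) continuous_on_plateau plateau_le
      Lp_integral_plateau_finite[OF less_imp_le[OF p]]
    by (intro Lp_bounded_at_dominated[of "?F n" "plateau n" n]) auto
  have "AE x in lebesgue. bdd_above (range (\<lambda>n. kernel_op k (?F n) x))"
  proof (rule incseq_Lp_bounded_imp_AE_bdd_above[OF p])
    show "kernel_op k (?F n) \<in> borel_measurable lebesgue" for n
      using F_bounded by (simp add: Lp_bounded_at_def)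
    show "incseq (\<lambda>n. kernel_op k (?F n) x)" for x
      by (intro incseq_kernel_op F_int incseq_truncate_at)
    have "Lp_integral p (?F n) \<le> Lp_integral p f" for n
      using p F_nonneg truncate_at_le(1) f_nonneg by (intro Lp_integral_mono) auto
    then show "Lp_integral p (kernel_op k (?F n)) \<le> ennreal A * Lp_integral p f" for n
      using F_bounded unfolding Lp_bounded_at_def by (meson mult_left_mono order.trans zero_le)
    show "ennreal A * Lp_integral p f < \<infinity>" using fin by (simp add: ennreal_mult_less_top)
  qed (intro kernel_op_nonneg F_nonneg)
  then have conv: "AE x in lebesgue. integrable lebesgue (\<lambda>y. k x y * f y) \<and>
      (\<lambda>n. kernel_op k (?F n) x) \<longlonglongrightarrow> kernel_op k f x"
    by eventually_elim
      (intro conjI kernel_op_monotone_convergence[OF F_int incseq_truncate_at truncate_at_tendsto _ f])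
  then show "AE x in lebesgue. integrable lebesgue (\<lambda>y. k x y * f y)" by eventually_elim simp
  show "Lp_bounded_at p A k f"
  proof (rule Lp_bounded_at_limit[OF p F_bounded])
    show "AE x in lebesgue. (\<lambda>n. kernel_op k (?F n) x) \<longlonglongrightarrow> kernel_op k f x"
      using conv by eventually_elim simp
    show "(\<lambda>n. Lp_integral p (?F n)) \<longlonglongrightarrow> Lp_integral p f"
    proof (rule Lp_integral_dominated_convergence[OF p borel_measurable_truncate_at[OF f] f f _ _ fin])
      show "\<bar>?F n x\<bar> \<le> \<bar>f x\<bar>" for n x using F_nonneg[of n x] truncate_at_le(1)[of n f x] by simp
    qed (simp add: truncate_at_tendsto)
  qed
qed

lemma Lp_bounded_at_Lp:
  assumes f[measurable]: "f \<in> borel_measurable lebesgue" and fin: "Lp_integral p f < \<infinity>"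
  shows "AE x in lebesgue. integrable lebesgue (\<lambda>y. k x y * f y)" and "Lp_bounded_at p A k f"
proof -
  define pos neg where "pos y = max 0 (f y)" and "neg y = max 0 (- f y)" for y
  have nonneg: "0 \<le> pos y" "0 \<le> neg y" and abs_le: "\<bar>pos y\<bar> \<le> \<bar>f y\<bar>" "\<bar>neg y\<bar> \<le> \<bar>f y\<bar>" for y
    by (auto simp: pos_def neg_def)
  have [measurable]: "pos \<in> borel_measurable lebesgue" "neg \<in> borel_measurable lebesgue"
    by (simp_all add: pos_def[abs_def] neg_def[abs_def])
  have "Lp_integral p pos < \<infinity>" "Lp_integral p neg < \<infinity>"
    by (rule le_less_trans[OF Lp_integral_mono fin]; use p abs_le in simp)+
  note pos = Lp_bounded_at_nonneg[of pos, OF _ nonneg(1) this(1), simplified]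
    and neg = Lp_bounded_at_nonneg[of neg, OF _ nonneg(2) this(2), simplified]
  have split: "k x y * f y = k x y * pos y - k x y * neg y" for x y
    by (simp add: pos_def neg_def max_def flip: right_diff_distrib)
  show "AE x in lebesgue. integrable lebesgue (\<lambda>y. k x y * f y)"
    using pos(1) neg(1) by eventually_elim (simp add: split)
  show "Lp_bounded_at p A k f"
    unfolding Lp_bounded_at_def
  proof
    have "AE x in lebesgue. kernel_op k pos x - kernel_op k neg x = kernel_op k f x"
      using pos(1) neg(1) by eventually_elim (simp add: split kernel_op_def)
    moreover have "(\<lambda>x. kernel_op k pos x - kernel_op k neg x) \<in> borel_measurable lebesgue"
      using pos(2) neg(2) unfolding Lp_bounded_at_def by (intro borel_measurable_diff) auto
    ultimately show "kernel_op k f \<in> borel_measurable lebesgue" by (rule borel_measurable_AE[rotated])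
    have "\<bar>kernel_op k f x\<bar> \<le> kernel_op k (\<lambda>y. \<bar>f y\<bar>) x" for x
      using integral_norm_bound[of lebesgue "\<lambda>y. k x y * f y"] by (simp add: kernel_op_def abs_mult k_nonneg)
    then have "Lp_integral p (kernel_op k f) \<le> Lp_integral p (kernel_op k (\<lambda>y. \<bar>f y\<bar>))"
      using p by (intro Lp_integral_mono) (auto intro: order.trans[OF _ abs_ge_self])
    also have "\<dots> \<le> ennreal A * Lp_integral p (\<lambda>y. \<bar>f y\<bar>)"
      using Lp_bounded_at_nonneg(2)[of "\<lambda>y. \<bar>f y\<bar>"] fin by (simp add: Lp_bounded_at_def Lp_integral_def)
    finally show "Lp_integral p (kernel_op k f) \<le> ennreal A * Lp_integral p f"
      by (simp add: Lp_integral_def)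
  qed
qed


end

section \<open>Partial derivatives and integrals over boxes\<close>

lemma has_partial_diff:
  assumes "has_partial f i x a" "has_partial g i x b"
  shows "has_partial (\<lambda>x. f x - g x) i x (a - b)"
  using assms unfolding has_partial_def by (rule DERIV_diff)

lemma has_partial_mult:
  assumes "has_partial f i x a" "has_partial g i x b"
  shows "has_partial (\<lambda>x. f x * g x) i x (a * g x + f x * b)"
  using DERIV_mult[OF assms[unfolded has_partial_def]] by (simp add: has_partial_def mult.commute)

lemma has_partial_cmult:
  assumes "has_partial f i x a"
  shows "has_partial (\<lambda>x. k * f x) i x (k * a)"
  using assms unfolding has_partial_def by (rule DERIV_cmult)

lemma has_partial_sum:
  assumes "\<And>j. j \<in> J \<Longrightarrow> has_partial (f j) i x (a j)"
  shows "has_partial (\<lambda>x. \<Sum>j\<in>J. f j x) i x (\<Sum>j\<in>J. a j)"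
  using assms unfolding has_partial_def by (rule DERIV_sum)

lemma has_partial_compose:
  assumes "has_partial f i x a" "(H has_real_derivative b) (at (f x))"
  shows "has_partial (\<lambda>x. H (f x)) i x (b * a)"
  using DERIV_chain2[of H b "\<lambda>h. f (x + h *\<^sub>R axis i 1)" 0 a] assms unfolding has_partial_def by simp

lemma has_partial_line:
  assumes "has_partial F i (x + h *\<^sub>R axis i 1) D"
  shows "((\<lambda>h. F (x + h *\<^sub>R axis i 1)) has_real_derivative D) (at h)"
proof -
  have "((\<lambda>k. F (x + (k + h) *\<^sub>R axis i 1)) has_real_derivative D) (at 0)"
    using assms by (simp add: has_partial_def algebra_simps)
  then show ?thesis
    using DERIV_shift[of "\<lambda>k. F (x + k *\<^sub>R axis i 1)" D 0 h] by simp
qed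

lemma has_partial_eq_0_on_open:
  assumes "open S" "x \<in> S" "\<And>y. y \<in> S \<Longrightarrow> F y = 0" "has_partial F i x D"
  shows "D = 0"
proof -
  obtain r where "0 < r" and ball: "ball x r \<subseteq> S"
    using assms(1,2) open_contains_ball by blast
  have "F (x + 0 *\<^sub>R axis i 1) = F (x + h *\<^sub>R axis i 1)" if "\<bar>0 - h\<bar> < r" for h
  proof -
    have "x + h *\<^sub>R axis i 1 \<in> S" using ball that by (auto simp: dist_norm norm_axis_1)
    then show ?thesis using assms(2,3) by simp
  qed
  then show ?thesis
    using DERIV_local_const[OF assms(4)[unfolded has_partial_def] \<open>0 < r\<close>] by blast
qed

lemma lborel_integral_translate:
  fixes F :: "'a::euclidean_space \<Rightarrow> real"
  assumes "F \<in> borel_measurable borel"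
  shows "integral\<^sup>L lborel (\<lambda>x. F (x + a)) = integral\<^sup>L lborel F"
proof -
  have "integral\<^sup>L lborel (\<lambda>x. F (x + a)) = integral\<^sup>L (distr lborel borel ((+) a)) F"
    using assms by (subst integral_distr) (simp_all add: add.commute)
  then show ?thesis by (simp add: lborel_distr_plus)
qed

lemma integral_cbox_eq_lborel:
  fixes F :: "'a::euclidean_space \<Rightarrow> real"
  assumes "continuous_on UNIV F" "\<And>x. x \<notin> cbox l r \<Longrightarrow> F x = 0"
  shows "integral (cbox l r) F = integral\<^sup>L lborel F"
proof -
  have F_eq: "(\<lambda>x. indicator (cbox l r) x *\<^sub>R F x) = F" "(\<lambda>x. if x \<in> cbox l r then F x else 0) = F"
    using assms(2) by (auto simp: fun_eq_iff indicator_def)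
  have "integrable lborel F"
    using borel_integrable_compact[OF compact_cbox continuous_on_subset[OF assms(1)], of l r] F_eq(1) by simp
  then have "integral UNIV F = integral\<^sup>L lborel F" by (rule integral_lborel)
  then show ?thesis using integral_restrict_UNIV[of "cbox l r" F] F_eq(2) by simp
qed

lemma continuous_on_slice:
  assumes "continuous_on (A \<times> B) (\<lambda>(t, x). F t x)" "t \<in> A"
  shows "continuous_on B (F t)"
proof -
  have "continuous_on B (\<lambda>x. case (t, x) of (t, x) \<Rightarrow> F t x)"
    by (rule continuous_on_compose2[OF assms(1)]) (use assms(2) in \<open>auto intro!: continuous_intros\<close>)
  then show ?thesis by simp
qed

lemma has_real_derivative_integral_compose:
  fixes w :: "real \<Rightarrow> 'a::euclidean_space \<Rightarrow> real"
  assumes H: "\<And>y. (H has_real_derivative H' y) (at y)" and H': "continuous_on UNIV H'"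
    and w: "continuous_on ({a<..<b} \<times> UNIV) (\<lambda>(t, x). w t x)"
    and Dt: "\<And>t x. t \<in> {a<..<b} \<Longrightarrow> ((\<lambda>\<tau>. w \<tau> x) has_real_derivative Dt t x) (at t)"
    and Dt_cont: "continuous_on ({a<..<b} \<times> UNIV) (\<lambda>(t, x). Dt t x)"
    and t: "t \<in> {a<..<b}"
  shows "((\<lambda>t. integral (cbox l r) (\<lambda>x. H (w t x))) has_real_derivative
    integral (cbox l r) (\<lambda>x. H' (w t x) * Dt t x)) (at t)"
proof -
  have "continuous_on UNIV H"
    using H by (auto simp: continuous_on_eq_continuous_at intro: DERIV_isCont)
  have "((\<lambda>t. integral (cbox l r) (\<lambda>x. H (w t x))) has_real_derivative
      integral (cbox l r) (\<lambda>x. H' (w t x) * Dt t x)) (at t within {a<..<b})"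
  proof (rule leibniz_rule_field_derivative[OF _ _ _ t])
    show "((\<lambda>\<tau>. H (w \<tau> x)) has_field_derivative H' (w \<tau> x) * Dt \<tau> x) (at \<tau> within {a<..<b})"
      if "\<tau> \<in> {a<..<b}" for \<tau> x
      by (rule has_field_derivative_at_within, rule DERIV_chain2[OF H Dt[OF that]])
    show "(\<lambda>x. H (w \<tau> x)) integrable_on cbox l r" if "\<tau> \<in> {a<..<b}" for \<tau>
      by (intro integrable_continuous continuous_on_compose2[OF \<open>continuous_on UNIV H\<close> _ subset_UNIV]
          continuous_on_subset[OF continuous_on_slice[OF w that] subset_UNIV])
    show "continuous_on ({a<..<b} \<times> cbox l r) (\<lambda>(t, x). H' (w t x) * Dt t x)"
      using w Dt_cont unfolding split_beta
      by (intro continuous_on_mult continuous_on_compose2[OF H' _ subset_UNIV])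
        (auto elim: continuous_on_subset)
  qed simp
  then show ?thesis using t at_within_open[of t "{a<..<b}"] by simp
qed

lemma bounded_translates_subset_cbox:
  fixes l r :: "'a::euclidean_space"
  obtains m where "\<And>x v. norm v \<le> 1 \<Longrightarrow> x + v \<in> cbox l r \<Longrightarrow> x \<in> cbox (- m) m"
proof -
  obtain R where R: "\<And>x. x \<in> cbox l r \<Longrightarrow> norm x \<le> R"
    using bounded_cbox[of l r] by (auto simp: bounded_iff)
  obtain m where m: "cball 0 (R + 1) \<subseteq> cbox (- m) (m :: 'a)"
    using bounded_subset_cbox_symmetric[of "cball 0 (R + 1)"] by auto
  have "x \<in> cbox (- m) m" if "norm v \<le> 1" "x + v \<in> cbox l r" for x v
  proof -
    have "norm x \<le> norm (x + v) + norm v" using norm_triangle_ineq4[of "x + v" v] by simp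
    then have "x \<in> cball 0 (R + 1)" using R[OF that(2)] that(1) by simp
    then show ?thesis using m by blast
  qed
  then show thesis by (rule that)
qed

lemma DERIV_integral_translate_axis:
  fixes F F' :: "real^'d \<Rightarrow> real"
  assumes part: "\<And>x. has_partial F i x (F' x)"
    and contF: "continuous_on UNIV F" and contF': "continuous_on UNIV F'"
  shows "((\<lambda>h. integral (cbox l r) (\<lambda>x. F (x + h *\<^sub>R axis i 1))) has_real_derivative
    integral (cbox l r) F') (at 0)"
proof -
  let ?e = "axis i 1 :: real^'d"
  have "((\<lambda>h. integral (cbox l r) (\<lambda>x. F (x + h *\<^sub>R ?e))) has_real_derivative
      integral (cbox l r) (\<lambda>x. 1 * F' (x + 0 *\<^sub>R ?e))) (at 0)"
  proof (rule has_real_derivative_integral_compose[of "\<lambda>y. y", where a = "-1" and b = 1])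
    show "((\<lambda>h. F (x + h *\<^sub>R ?e)) has_real_derivative F' (x + h *\<^sub>R ?e)) (at h)" for h x
      by (rule has_partial_line[OF part])
    have "continuous_on S (\<lambda>(h, x). x + h *\<^sub>R ?e)" for S
      unfolding split_beta by (intro continuous_intros)
    then show "continuous_on ({-1<..<1} \<times> UNIV) (\<lambda>(h, x). F (x + h *\<^sub>R ?e))"
      and "continuous_on ({-1<..<1} \<times> UNIV) (\<lambda>(h, x). F' (x + h *\<^sub>R ?e))"
      using continuous_on_compose2[OF contF _ subset_UNIV] continuous_on_compose2[OF contF' _ subset_UNIV]
      unfolding split_beta by blast+
  qed simp_all
  then show ?thesis by simp
qed

text \<open>By translation invariance \<open>\<integral> F (x + h e\<^sub>i) dx\<close> does not depend on \<open>h\<close>, and its derivative at \<open>h = 0\<close>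
  is the integral in question.\<close>

lemma integral_partial_eq_0:
  fixes F F' :: "real^'d \<Rightarrow> real"
  assumes part: "\<And>x. has_partial F i x (F' x)"
    and contF: "continuous_on UNIV F" and contF': "continuous_on UNIV F'"
    and zero: "\<And>x. x \<notin> cbox l r \<Longrightarrow> F x = 0"
  shows "integral (cbox l r) F' = 0"
proof -
  let ?e = "axis i 1 :: real^'d"
  obtain m where m: "\<And>x v. norm v \<le> 1 \<Longrightarrow> x + v \<in> cbox l r \<Longrightarrow> x \<in> cbox (- m) (m :: real^'d)"
    using bounded_translates_subset_cbox[of l r] by blast
  have const: "integral (cbox (- m) m) (\<lambda>x. F (x + h *\<^sub>R ?e)) = integral\<^sup>L lborel F" if "h \<in> {-1<..<1}" for h
  proof -
    have "norm (h *\<^sub>R ?e) \<le> 1" using that by (simp add: norm_axis_1 abs_le_iff)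
    then have "F (x + h *\<^sub>R ?e) = 0" if "x \<notin> cbox (- m) m" for x
      using m zero that by blast
    moreover have "continuous_on UNIV (\<lambda>x. F (x + h *\<^sub>R ?e))"
      by (rule continuous_on_compose2[OF contF]) (auto intro!: continuous_intros)
    ultimately show ?thesis
      using lborel_integral_translate[of F "h *\<^sub>R ?e"] contF
      by (simp add: integral_cbox_eq_lborel borel_measurable_continuous_onI)
  qed
  have "((\<lambda>h. integral (cbox (- m) m) (\<lambda>x. F (x + h *\<^sub>R ?e))) has_real_derivative 0) (at 0)"
    by (rule has_field_derivative_transform_within_open[of "\<lambda>_. integral\<^sup>L lborel F" _ _ "{-1<..<1}"])
      (auto simp: const)
  then have "integral (cbox (- m) m) F' = 0"
    by (rule DERIV_unique[OF DERIV_integral_translate_axis[OF part contF contF']])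
  moreover have "integral (cbox (- m) m) F' = integral (cbox l r) F'"
  proof -
    have "open (- cbox l r)" by (simp add: closed_cbox open_Compl)
    then have zero': "F' x = 0" if "x \<notin> cbox l r" for x
      using has_partial_eq_0_on_open[OF _ _ _ part] zero that by blast
    have "x \<in> cbox (- m) m" if "x \<in> cbox l r" for x using m[of 0 x] that by simp
    then have "F' x = 0" if "x \<notin> cbox (- m) m" for x using zero' that by blast
    with zero' show ?thesis using contF' by (simp add: integral_cbox_eq_lborel)
  qed
  ultimately show ?thesis by simp
qed

lemma gronwall:
  fixes f f' :: "real \<Rightarrow> real"
  assumes "a \<le> b" and cont: "continuous_on {a..b} f"
    and deriv: "\<And>t. t \<in> {a<..<b} \<Longrightarrow> (f has_real_derivative f' t) (at t)"
    and le: "\<And>t. t \<in> {a<..<b} \<Longrightarrow> f' t \<le> k * f t"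
  shows "f b \<le> exp (k * (b - a)) * f a"
proof -
  have "exp (- (k * b)) * f b \<le> exp (- (k * a)) * f a"
  proof (rule DERIV_nonpos_imp_decreasing_open[OF assms(1), of "\<lambda>t. exp (- (k * t)) * f t"])
    show "continuous_on {a..b} (\<lambda>t. exp (- (k * t)) * f t)"
      by (intro continuous_intros cont)
    fix t assume "a < t" "t < b"
    then have "((\<lambda>t. exp (- (k * t)) * f t) has_real_derivative exp (- (k * t)) * (f' t - k * f t)) (at t)"
      and "exp (- (k * t)) * (f' t - k * f t) \<le> 0"
      using deriv[of t] le[of t] by (auto intro!: derivative_eq_intros simp: algebra_simps mult_le_0_iff)
    then show "\<exists>y. ((\<lambda>t. exp (- (k * t)) * f t) has_real_derivative y) (at t) \<and> y \<le> 0" by blast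
  qed
  then have "exp (k * b) * (exp (- (k * b)) * f b) \<le> exp (k * b) * (exp (- (k * a)) * f a)"
    by (intro mult_left_mono) auto
  then show ?thesis
    by (simp add: mult.assoc[symmetric] right_diff_distrib flip: exp_add)
qed

lemma Lp_integral_eq_integral_cbox:
  fixes f :: "'a::euclidean_space \<Rightarrow> real"
  assumes "0 < p" "continuous_on UNIV f" "\<And>x. x \<notin> cbox l r \<Longrightarrow> f x = 0"
  shows "Lp_integral p f = ennreal (integral (cbox l r) (\<lambda>x. \<bar>f x\<bar> powr p))"
proof -
  have "continuous_on (cbox l r) (\<lambda>x. \<bar>f x\<bar> powr p)"
    using assms(1) continuous_on_subset[OF assms(2) subset_UNIV]
    by (intro continuous_on_powr' continuous_intros) auto
  from nn_integral_has_integral_lebesgue[OF _ integrable_integral[OF integrable_continuous[OF this]]]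
  have "(\<integral>\<^sup>+x. ennreal (indicator (cbox l r) x * \<bar>f x\<bar> powr p) \<partial>lborel)
      = ennreal (integral (cbox l r) (\<lambda>x. \<bar>f x\<bar> powr p))"
    by simp
  moreover have "indicator (cbox l r) x * \<bar>f x\<bar> powr p = \<bar>f x\<bar> powr p" for x
    using assms(3)[of x] by (auto simp: indicator_def)
  ultimately show ?thesis by (simp add: Lp_integral_def nn_integral_completion)
qed

lemma integral_smooth_powr_bounds:
  fixes v :: "'a::euclidean_space \<Rightarrow> real"
  assumes \<delta>: "0 < \<delta>" and p: "1 < p" and v: "continuous_on (cbox l r) v"
    and M: "\<And>x. x \<in> cbox l r \<Longrightarrow> v x \<le> M"
  defines "e \<equiv> 3 * \<delta> * M powr (p - 1) * measure lborel (cbox l r)"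
  shows "integral (cbox l r) (\<lambda>x. smooth_powr p \<delta> (v x)) \<le> integral (cbox l r) (\<lambda>x. max 0 (v x) powr p)"
    and "integral (cbox l r) (\<lambda>x. max 0 (v x) powr p) \<le> integral (cbox l r) (\<lambda>x. smooth_powr p \<delta> (v x)) + e"
    and "integral (cbox l r) (\<lambda>x. v x * smooth_powr' p \<delta> (v x))
      \<le> p * integral (cbox l r) (\<lambda>x. smooth_powr p \<delta> (v x)) + e"
proof -
  have smooth_int: "(\<lambda>x. smooth_powr p \<delta> (v x)) integrable_on cbox l r"
    and mult_int: "(\<lambda>x. v x * smooth_powr' p \<delta> (v x)) integrable_on cbox l r"
    by (intro integrable_continuous continuous_intros \<delta> v)+
  have powr_int: "(\<lambda>x. max 0 (v x) powr p) integrable_on cbox l r"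
    using p by (intro integrable_continuous continuous_on_powr' continuous_intros v) auto
  show "integral (cbox l r) (\<lambda>x. smooth_powr p \<delta> (v x)) \<le> integral (cbox l r) (\<lambda>x. max 0 (v x) powr p)"
    by (intro integral_le smooth_int powr_int smooth_powr_le \<delta>)
  have plus_const_int: "(\<lambda>x. k * smooth_powr p \<delta> (v x) + 3 * \<delta> * M powr (p - 1)) integrable_on cbox l r" for k
    by (intro integrable_continuous continuous_intros \<delta> v)
  have integral_plus_const: "integral (cbox l r) (\<lambda>x. k * smooth_powr p \<delta> (v x) + 3 * \<delta> * M powr (p - 1))
        = k * integral (cbox l r) (\<lambda>x. smooth_powr p \<delta> (v x)) + e" for k
    using smooth_int by (subst integral_add) (auto simp: e_def integrable_on_mult_right)
  show "integral (cbox l r) (\<lambda>x. max 0 (v x) powr p) \<le> integral (cbox l r) (\<lambda>x. smooth_powr p \<delta> (v x)) + e"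
    using integral_le[OF powr_int plus_const_int[of 1]] max_0_powr_le_smooth_powr[OF \<delta> p M]
      integral_plus_const[of 1] by simp
  show "integral (cbox l r) (\<lambda>x. v x * smooth_powr' p \<delta> (v x))
      \<le> p * integral (cbox l r) (\<lambda>x. smooth_powr p \<delta> (v x)) + e"
    using integral_le[OF mult_int plus_const_int[of p]] mult_smooth_powr'_le[OF \<delta> p M]
      integral_plus_const[of p] by simp
qed

section \<open>The energy inequality for subsolutions\<close>

definition C12_strip_with ::
    "real \<Rightarrow> real \<Rightarrow> (real \<Rightarrow> real^'d \<Rightarrow> real) \<Rightarrow> (real \<Rightarrow> real^'d \<Rightarrow> real)
      \<Rightarrow> ('d \<Rightarrow> real \<Rightarrow> real^'d \<Rightarrow> real) \<Rightarrow> ('d \<Rightarrow> 'd \<Rightarrow> real \<Rightarrow> real^'d \<Rightarrow> real) \<Rightarrow> bool" where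
  "C12_strip_with s T u Dt Du D2u \<longleftrightarrow>
     continuous_on ({s..T} \<times> UNIV) (\<lambda>(t, x). u t x) \<and>
     continuous_on ({s<..<T} \<times> UNIV) (\<lambda>(t, x). Dt t x) \<and>
     (\<forall>t\<in>{s<..<T}. (\<forall>x. ((\<lambda>\<tau>. u \<tau> x) has_real_derivative Dt t x) (at t)) \<and>
        C2_with (u t) (\<lambda>i. Du i t) (\<lambda>i j. D2u i j t))"

lemma C12_strip_withD:
  assumes "C12_strip_with s T u Dt Du D2u"
  shows "continuous_on ({s..T} \<times> UNIV) (\<lambda>(t, x). u t x)"
    and "continuous_on ({s<..<T} \<times> UNIV) (\<lambda>(t, x). Dt t x)"
    and "t \<in> {s<..<T} \<Longrightarrow> ((\<lambda>\<tau>. u \<tau> x) has_real_derivative Dt t x) (at t)"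
    and "t \<in> {s<..<T} \<Longrightarrow> C2_with (u t) (\<lambda>i. Du i t) (\<lambda>i j. D2u i j t)"
  using assms by (auto simp: C12_strip_with_def)

definition subsolution_on ::
    "(real \<Rightarrow> real^'d \<Rightarrow> 'd \<Rightarrow> 'd \<Rightarrow> real) \<Rightarrow> (real \<Rightarrow> real^'d \<Rightarrow> 'd \<Rightarrow> real) \<Rightarrow> (real \<Rightarrow> real^'d \<Rightarrow> real)
      \<Rightarrow> real \<Rightarrow> real \<Rightarrow> (real \<Rightarrow> real^'d \<Rightarrow> real) \<Rightarrow> bool" where
  "subsolution_on Q B c s T w \<longleftrightarrow>
     (\<exists>Dt Dw D2w. C12_strip_with s T w Dt Dw D2w \<and>
        (\<forall>t\<in>{s<..<T}. \<forall>x. Dt t x \<le> Aop Q B c t x (w t x) (\<lambda>i. Dw i t x) (\<lambda>i j. D2w i j t x)))"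

lemma subsolution_on_continuous:
  assumes "subsolution_on Q B c s T w"
  shows "continuous_on ({s..T} \<times> UNIV) (\<lambda>(t, x). w t x)"
    and "t \<in> {s..T} \<Longrightarrow> continuous_on UNIV (w t)"
  using assms C12_strip_withD(1) continuous_on_slice unfolding subsolution_on_def by blast+

lemma young_sum:
  fixes a b :: "'i \<Rightarrow> real"
  assumes "0 < A"
  shows "(\<Sum>i\<in>S. a i * b i) \<le> A * (\<Sum>i\<in>S. (b i)\<^sup>2) + (\<Sum>i\<in>S. (a i)\<^sup>2) / (4 * A)"
proof -
  have "a i * b i \<le> A * (b i)\<^sup>2 + (a i)\<^sup>2 / (4 * A)" for i
  proof -
    have "0 \<le> (2 * A * b i - a i)\<^sup>2 / (4 * A)" using assms by simp
    also have "\<dots> = A * (b i)\<^sup>2 + (a i)\<^sup>2 / (4 * A) - a i * b i"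
      using assms by (simp add: field_simps power2_eq_square)
    finally show ?thesis by simp
  qed
  then have "(\<Sum>i\<in>S. a i * b i) \<le> (\<Sum>i\<in>S. A * (b i)\<^sup>2 + (a i)\<^sup>2 / (4 * A))" by (rule sum_mono)
  then show ?thesis by (simp add: sum.distrib sum_distrib_left sum_divide_distrib)
qed

locale dissipative_coefficients =
  fixes p K s T :: real
    and Q :: "real \<Rightarrow> real^'d \<Rightarrow> 'd \<Rightarrow> 'd \<Rightarrow> real"
    and B :: "real \<Rightarrow> real^'d \<Rightarrow> 'd \<Rightarrow> real"
    and c \<eta> :: "real \<Rightarrow> real^'d \<Rightarrow> real"
    and DQ :: "'d \<Rightarrow> 'd \<Rightarrow> 'd \<Rightarrow> real \<Rightarrow> real^'d \<Rightarrow> real"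
  assumes p: "1 < p" and K: "0 \<le> K" and s_less_T: "s < T"
    and Q_sym: "\<And>t x i j. t \<in> {s<..<T} \<Longrightarrow> Q t x i j = Q t x j i"
    and Q_cont: "\<And>t i j. t \<in> {s<..<T} \<Longrightarrow> continuous_on UNIV (\<lambda>x. Q t x i j)"
    and DQ: "\<And>t x i j k. t \<in> {s<..<T} \<Longrightarrow> has_partial (\<lambda>y. Q t y i j) k x (DQ k i j t x)"
    and DQ_cont: "\<And>t i j k. t \<in> {s<..<T} \<Longrightarrow> continuous_on UNIV (DQ k i j t)"
    and \<eta>_pos: "\<And>t x. t \<in> {s<..<T} \<Longrightarrow> 0 < \<eta> t x"
    and elliptic: "\<And>t x \<xi>. t \<in> {s<..<T} \<Longrightarrow>
        \<eta> t x * (norm \<xi>)\<^sup>2 \<le> (\<Sum>i\<in>UNIV. \<Sum>j\<in>UNIV. Q t x i j * \<xi>$i * \<xi>$j)"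
    and dissipative: "\<And>t x. t \<in> {s<..<T} \<Longrightarrow>
        (\<Sum>i\<in>UNIV. (B t x i - (\<Sum>j\<in>UNIV. DQ j i j t x))\<^sup>2) / (4 * (p - 1) * \<eta> t x) - c t x \<le> K"
begin

definition drift :: "real \<Rightarrow> real^'d \<Rightarrow> 'd \<Rightarrow> real" where
  "drift t x i = B t x i - (\<Sum>j\<in>UNIV. DQ j i j t x)"

definition flux :: "real \<Rightarrow> ('d \<Rightarrow> real^'d \<Rightarrow> real) \<Rightarrow> 'd \<Rightarrow> real^'d \<Rightarrow> real" where
  "flux t Dv i x = (\<Sum>j\<in>UNIV. Q t x j i * Dv j x)"

definition partial_flux ::
    "real \<Rightarrow> ('d \<Rightarrow> real^'d \<Rightarrow> real) \<Rightarrow> ('d \<Rightarrow> 'd \<Rightarrow> real^'d \<Rightarrow> real) \<Rightarrow> 'd \<Rightarrow> real^'d \<Rightarrow> real" where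
  "partial_flux t Dv D2v i x = (\<Sum>j\<in>UNIV. DQ i j i t x * Dv j x + Q t x j i * D2v i j x)"

lemma has_partial_flux:
  assumes "t \<in> {s<..<T}" "C2_with v Dv D2v"
  shows "has_partial (flux t Dv i) i x (partial_flux t Dv D2v i x)"
  unfolding flux_def[abs_def] partial_flux_def
  using assms DQ by (intro has_partial_sum has_partial_mult) (auto simp: C2_with_def)

lemma continuous_on_flux:
  assumes "t \<in> {s<..<T}" "C2_with v Dv D2v"
  shows "continuous_on UNIV (flux t Dv i)" "continuous_on UNIV (partial_flux t Dv D2v i)"
  unfolding flux_def[abs_def] partial_flux_def[abs_def]
  using assms Q_cont DQ_cont by (auto simp: C2_with_def intro!: continuous_intros)

lemma Aop_divergence_form:
  assumes "t \<in> {s<..<T}"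
  shows "Aop Q B c t x u (\<lambda>i. Dv i x) (\<lambda>i j. D2v i j x)
    = (\<Sum>i\<in>UNIV. partial_flux t Dv D2v i x) + (\<Sum>i\<in>UNIV. drift t x i * Dv i x) - c t x * u"
proof -
  have "(\<Sum>i\<in>UNIV. \<Sum>j\<in>UNIV. DQ i j i t x * Dv j x) = (\<Sum>i\<in>UNIV. (\<Sum>j\<in>UNIV. DQ j i j t x) * Dv i x)"
    by (subst sum.swap) (simp add: sum_distrib_right)
  moreover have "(\<Sum>i\<in>UNIV. \<Sum>j\<in>UNIV. Q t x j i * D2v i j x) = (\<Sum>i\<in>UNIV. \<Sum>j\<in>UNIV. Q t x i j * D2v i j x)"
    by (intro sum.cong refl arg_cong2[where f = "(*)"] Q_sym[OF assms])
  ultimately show ?thesis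
    by (simp add: Aop_def partial_flux_def drift_def sum.distrib sum_subtractf left_diff_distrib)
qed

lemma drift_le_dissipation:
  fixes z :: "'d \<Rightarrow> real"
  assumes t: "t \<in> {s<..<T}" and w: "0 < w"
  shows "(\<Sum>i\<in>UNIV. drift t x i * z i) - c t x * w
    \<le> (p - 1) / w * (\<Sum>i\<in>UNIV. \<Sum>j\<in>UNIV. Q t x i j * z i * z j) + K * w"
proof -
  define A where "A = (p - 1) * \<eta> t x / w"
  have "0 < A" using p \<eta>_pos[OF t] w by (simp add: A_def)
  have "(\<Sum>i\<in>UNIV. drift t x i * z i) \<le> A * (\<Sum>i\<in>UNIV. (z i)\<^sup>2) + (\<Sum>i\<in>UNIV. (drift t x i)\<^sup>2) / (4 * A)"
    using \<open>0 < A\<close> by (rule young_sum)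
  also have "A * (\<Sum>i\<in>UNIV. (z i)\<^sup>2) \<le> (p - 1) / w * (\<Sum>i\<in>UNIV. \<Sum>j\<in>UNIV. Q t x i j * z i * z j)"
  proof -
    have "\<eta> t x * (\<Sum>i\<in>UNIV. (z i)\<^sup>2) \<le> (\<Sum>i\<in>UNIV. \<Sum>j\<in>UNIV. Q t x i j * z i * z j)"
      using elliptic[OF t, of x "\<chi> i. z i"] by (simp add: norm_vec_def L2_set_def sum_nonneg)
    then have "(p - 1) / w * (\<eta> t x * (\<Sum>i\<in>UNIV. (z i)\<^sup>2))
        \<le> (p - 1) / w * (\<Sum>i\<in>UNIV. \<Sum>j\<in>UNIV. Q t x i j * z i * z j)"
      using p w by (intro mult_left_mono) auto
    then show ?thesis by (simp add: A_def)
  qed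
  also have "(\<Sum>i\<in>UNIV. (drift t x i)\<^sup>2) / (4 * A) = w * ((\<Sum>i\<in>UNIV. (drift t x i)\<^sup>2) / (4 * (p - 1) * \<eta> t x))"
    using w by (simp add: A_def field_simps)
  also have "\<dots> \<le> w * (K + c t x)"
    using dissipative[OF t, of x] w by (intro mult_left_mono) (auto simp: drift_def)
  finally show ?thesis by (simp add: algebra_simps)
qed

lemma energy_density_le:
  assumes t: "t \<in> {s<..<T}" and h: "0 \<le> h" "(p - 1) * h \<le> w * h'" and w: "w \<le> 0 \<Longrightarrow> h = 0 \<and> h' = 0"
  shows "h * Aop Q B c t x w (\<lambda>i. Dv i x) (\<lambda>i j. D2v i j x)
    \<le> (\<Sum>i\<in>UNIV. h' * Dv i x * flux t Dv i x + h * partial_flux t Dv D2v i x) + K * (h * w)"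
proof (cases "0 < w")
  case True
  let ?form = "\<Sum>i\<in>UNIV. \<Sum>j\<in>UNIV. Q t x i j * Dv i x * Dv j x"
  have "0 \<le> \<eta> t x * (norm (\<chi> i. Dv i x))\<^sup>2" using \<eta>_pos[OF t, of x] by simp
  also have "\<dots> \<le> ?form" using elliptic[OF t, of x "\<chi> i. Dv i x"] by simp
  finally have "0 \<le> ?form" .
  have "h * ((\<Sum>i\<in>UNIV. drift t x i * Dv i x) - c t x * w) \<le> h * ((p - 1) / w * ?form + K * w)"
    using drift_le_dissipation[OF t True] h(1) by (rule mult_left_mono)
  also have "\<dots> = (p - 1) * h / w * ?form + K * (h * w)" by (simp add: algebra_simps)
  also have "(p - 1) * h / w * ?form \<le> h' * ?form"
    using h(2) True \<open>0 \<le> ?form\<close> by (intro mult_right_mono) (simp_all add: field_simps)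
  also have "?form = (\<Sum>i\<in>UNIV. Dv i x * flux t Dv i x)"
    using Q_sym[OF t] by (simp add: flux_def sum_distrib_left mult_ac)
  finally show ?thesis
    by (simp add: Aop_divergence_form[OF t] sum.distrib sum_distrib_left algebra_simps)
qed (use w in simp)

definition partial_weighted_flux ::
    "real \<Rightarrow> real \<Rightarrow> (real^'d \<Rightarrow> real) \<Rightarrow> ('d \<Rightarrow> real^'d \<Rightarrow> real) \<Rightarrow> ('d \<Rightarrow> 'd \<Rightarrow> real^'d \<Rightarrow> real)
      \<Rightarrow> 'd \<Rightarrow> real^'d \<Rightarrow> real" where
  "partial_weighted_flux \<delta> t v Dv D2v i x =
     smooth_powr'' p \<delta> (v x) * Dv i x * flux t Dv i x + smooth_powr' p \<delta> (v x) * partial_flux t Dv D2v i x"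

lemma continuous_on_partial_weighted_flux:
  assumes "t \<in> {s<..<T}" "0 < \<delta>" "C2_with v Dv D2v"
  shows "continuous_on UNIV (partial_weighted_flux \<delta> t v Dv D2v i)"
  unfolding partial_weighted_flux_def[abs_def]
  using assms by (intro continuous_intros continuous_on_flux[OF assms(1,3)]) (simp_all add: C2_with_def)

lemma integral_partial_weighted_flux_eq_0:
  assumes t: "t \<in> {s<..<T}" and \<delta>: "0 < \<delta>" and v: "C2_with v Dv D2v"
    and outside: "\<And>x. x \<notin> cbox l r \<Longrightarrow> v x \<le> 0"
  shows "integral (cbox l r) (partial_weighted_flux \<delta> t v Dv D2v i) = 0"
proof (rule integral_partial_eq_0[OF _ _ continuous_on_partial_weighted_flux[OF t \<delta> v]])
  let ?F = "\<lambda>x. smooth_powr' p \<delta> (v x) * flux t Dv i x"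
  have v_part: "has_partial v i x (Dv i x)" for x
    using v by (simp add: C2_with_def)
  show "has_partial ?F i x (partial_weighted_flux \<delta> t v Dv D2v i x)" for x
    unfolding partial_weighted_flux_def
    by (rule has_partial_mult[OF has_partial_compose[OF v_part DERIV_smooth_powr'[OF \<delta>]]
          has_partial_flux[OF t v]])
  show "continuous_on UNIV ?F"
    using v by (intro continuous_intros \<delta> continuous_on_flux[OF t v]) (simp add: C2_with_def)
  show "?F x = 0" if "x \<notin> cbox l r" for x
    using outside[OF that] \<delta> by (simp add: smooth_powr_eq_0)
qed

lemma integral_dissipative:
  assumes t: "t \<in> {s<..<T}" and \<delta>: "0 < \<delta>" and v: "C2_with v Dv D2v"
    and outside: "\<And>x. x \<notin> cbox l r \<Longrightarrow> v x \<le> 0"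
    and f_cont: "continuous_on UNIV f"
    and f_le: "\<And>x. f x \<le> Aop Q B c t x (v x) (\<lambda>i. Dv i x) (\<lambda>i j. D2v i j x)"
  shows "integral (cbox l r) (\<lambda>x. smooth_powr' p \<delta> (v x) * f x)
    \<le> K * integral (cbox l r) (\<lambda>x. v x * smooth_powr' p \<delta> (v x))"
proof -
  let ?h = "\<lambda>x. smooth_powr' p \<delta> (v x)" and ?F' = "partial_weighted_flux \<delta> t v Dv D2v"
  have v_cont: "continuous_on UNIV v" using v by (simp add: C2_with_def)
  note F'_cont = continuous_on_partial_weighted_flux[OF t \<delta> v]
  have integrable: "g integrable_on cbox l r" if "continuous_on UNIV g" for g :: "real^'d \<Rightarrow> real"
    by (rule integrable_continuous[OF continuous_on_subset[OF that subset_UNIV]])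
  have rest_cont: "continuous_on UNIV (\<lambda>x. v x * ?h x)" by (intro continuous_intros \<delta> v_cont)
  have "integral (cbox l r) (\<lambda>x. ?h x * f x)
      \<le> integral (cbox l r) (\<lambda>x. (\<Sum>i\<in>UNIV. ?F' i x) + K * (v x * ?h x))"
  proof (rule integral_le)
    fix x
    have "?h x * f x \<le> ?h x * Aop Q B c t x (v x) (\<lambda>i. Dv i x) (\<lambda>i j. D2v i j x)"
      by (intro mult_left_mono f_le smooth_powr'_nonneg \<delta> p)
    also have "\<dots> \<le> (\<Sum>i\<in>UNIV. ?F' i x) + K * (?h x * v x)"
      unfolding partial_weighted_flux_def using \<delta>
      by (intro energy_density_le t smooth_powr'_nonneg smooth_powr''_ge p) (auto intro!: smooth_powr_eq_0)
    finally show "?h x * f x \<le> (\<Sum>i\<in>UNIV. ?F' i x) + K * (v x * ?h x)" by (simp add: mult.commute)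
  qed (intro integrable continuous_intros \<delta> v_cont f_cont F'_cont)+
  also have "\<dots> = (\<Sum>i\<in>UNIV. integral (cbox l r) (?F' i)) + K * integral (cbox l r) (\<lambda>x. v x * ?h x)"
    using integrable[OF F'_cont] integrable[OF rest_cont]
    by (simp add: integral_add integrable_sum integral_sum integrable_on_mult_right)
  finally show ?thesis by (simp add: integral_partial_weighted_flux_eq_0[OF t \<delta> v outside])
qed

lemma smooth_energy_le:
  assumes w: "subsolution_on Q B c s T w"
    and outside: "\<And>t x. t \<in> {s..T} \<Longrightarrow> x \<notin> cbox l r \<Longrightarrow> w t x \<le> 0"
    and \<delta>: "0 < \<delta>" and M: "\<And>t x. t \<in> {s..T} \<Longrightarrow> x \<in> cbox l r \<Longrightarrow> w t x \<le> M"
  defines "e \<equiv> 3 * \<delta> * M powr (p - 1) * measure lborel (cbox l r) / p"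
  shows "integral (cbox l r) (\<lambda>x. smooth_powr p \<delta> (w T x)) + e
    \<le> exp (p * K * (T - s)) * (integral (cbox l r) (\<lambda>x. smooth_powr p \<delta> (w s x)) + e)"
proof -
  obtain Dt Dw D2w where C12: "C12_strip_with s T w Dt Dw D2w"
    and sub: "\<And>t x. t \<in> {s<..<T} \<Longrightarrow> Dt t x \<le> Aop Q B c t x (w t x) (\<lambda>i. Dw i t x) (\<lambda>i j. D2w i j t x)"
    using w unfolding subsolution_on_def by blast
  note w_cont = C12_strip_withD(1)[OF C12] and Dt_cont = C12_strip_withD(2)[OF C12]
  let ?E = "\<lambda>t. integral (cbox l r) (\<lambda>x. smooth_powr p \<delta> (w t x))"
  let ?E' = "\<lambda>t. integral (cbox l r) (\<lambda>x. smooth_powr' p \<delta> (w t x) * Dt t x)"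
  show ?thesis
  proof (rule gronwall[of s T "\<lambda>t. ?E t + e" ?E'])
    have "continuous_on ({s..T} \<times> cbox l r) (\<lambda>(t, x). smooth_powr p \<delta> (w t x))"
      using w_cont unfolding split_beta
      by (intro continuous_intros \<delta>) (auto elim: continuous_on_subset)
    then show "continuous_on {s..T} (\<lambda>t. ?E t + e)"
      by (intro continuous_intros integral_continuous_on_param)
    fix t assume t: "t \<in> {s<..<T}"
    have "continuous_on UNIV (smooth_powr' p \<delta>)"
      using continuous_on_smooth_powr(2)[OF \<delta> continuous_on_id] by (simp add: id_def)
    moreover have "continuous_on ({s<..<T} \<times> UNIV) (\<lambda>(t, x). w t x)"
      by (rule continuous_on_subset[OF w_cont]) auto
    ultimately have "(?E has_real_derivative ?E' t) (at t)"
      using has_real_derivative_integral_compose[OF DERIV_smooth_powr[OF \<delta>] _ _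
          C12_strip_withD(3)[OF C12] Dt_cont t]
      by blast
    then show "((\<lambda>t. ?E t + e) has_real_derivative ?E' t) (at t)"
      by (auto intro!: derivative_eq_intros)
    have "?E' t \<le> K * integral (cbox l r) (\<lambda>x. w t x * smooth_powr' p \<delta> (w t x))"
      using t outside
      by (intro integral_dissipative[OF t \<delta> C12_strip_withD(4)[OF C12 t] _
            continuous_on_slice[OF Dt_cont t]] sub) auto
    also have "\<dots> \<le> K * (p * ?E t + 3 * \<delta> * M powr (p - 1) * measure lborel (cbox l r))"
      using t continuous_on_subset[OF subsolution_on_continuous(2)[OF w] subset_UNIV]
      by (intro mult_left_mono integral_smooth_powr_bounds(3)[OF \<delta> p _ M] K) auto
    also have "\<dots> = p * K * (?E t + e)" using p by (simp add: e_def field_simps)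
    finally show "?E' t \<le> p * K * (?E t + e)" .
  qed (use s_less_T in simp)
qed

lemma subsolution_energy_le:
  assumes w: "subsolution_on Q B c s T w"
    and outside: "\<And>t x. t \<in> {s..T} \<Longrightarrow> x \<notin> cbox l r \<Longrightarrow> w t x \<le> 0"
  shows "Lp_integral p (\<lambda>x. max 0 (w T x))
    \<le> ennreal (exp (p * K * (T - s))) * Lp_integral p (\<lambda>x. max 0 (w s x))"
proof -
  have "compact ((\<lambda>(t, x). w t x) ` ({s..T} \<times> cbox l r))"
    by (intro compact_continuous_image compact_Times compact_Icc compact_cbox
        continuous_on_subset[OF subsolution_on_continuous(1)[OF w]]) auto
  then have "bdd_above ((\<lambda>(t, x). w t x) ` ({s..T} \<times> cbox l r))"
    by (intro bounded_imp_bdd_above compact_imp_bounded)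
  then obtain M where M: "\<And>t x. t \<in> {s..T} \<Longrightarrow> x \<in> cbox l r \<Longrightarrow> w t x \<le> M"
    unfolding bdd_above_def by force
  define C where "C = 3 * M powr (p - 1) * measure lborel (cbox l r)"
  define E where "E t = integral (cbox l r) (\<lambda>x. max 0 (w t x) powr p)" for t
  define E\<delta> where "E\<delta> \<delta> t = integral (cbox l r) (\<lambda>x. smooth_powr p \<delta> (w t x))" for \<delta> t
  have s: "s \<in> {s..T}" and T: "T \<in> {s..T}" using s_less_T by auto
  have "E T \<le> exp (p * K * (T - s)) * (E s + \<delta> * C / p) + \<delta> * C" if \<delta>: "0 < \<delta>" for \<delta>
  proof -
    have bounds: "E\<delta> \<delta> t \<le> E t" "E t \<le> E\<delta> \<delta> t + \<delta> * C" if t: "t \<in> {s..T}" for t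
      using integral_smooth_powr_bounds(1,2)[OF \<delta> p
          continuous_on_subset[OF subsolution_on_continuous(2)[OF w t]] M[OF t]]
      by (simp_all add: E_def E\<delta>_def C_def mult_ac)
    have "0 \<le> \<delta> * C / p" using \<delta> p by (simp add: C_def)
    have "E\<delta> \<delta> T + \<delta> * C / p \<le> exp (p * K * (T - s)) * (E\<delta> \<delta> s + \<delta> * C / p)"
      using smooth_energy_le[OF w outside \<delta> M] by (simp add: E\<delta>_def C_def mult_ac)
    also have "\<dots> \<le> exp (p * K * (T - s)) * (E s + \<delta> * C / p)" using bounds(1)[OF s] by simp
    finally show ?thesis using bounds(2)[OF T] \<open>0 \<le> \<delta> * C / p\<close> by linarith
  qed
  then have "\<forall>\<^sub>F \<delta> in at_right 0. E T \<le> exp (p * K * (T - s)) * (E s + \<delta> * C / p) + \<delta> * C"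
    by (simp add: eventually_at_filter)
  moreover have "((\<lambda>\<delta>. exp (p * K * (T - s)) * (E s + \<delta> * C / p) + \<delta> * C) \<longlongrightarrow>
      exp (p * K * (T - s)) * (E s + 0 * C / p) + 0 * C) (at_right 0)"
    using p by (intro tendsto_intros) auto
  ultimately have "E T \<le> exp (p * K * (T - s)) * E s"
    using tendsto_lowerbound[of _ _ "at_right 0" "E T"] by fastforce
  moreover have "Lp_integral p (\<lambda>x. max 0 (w t x)) = ennreal (E t)" if t: "t \<in> {s..T}" for t
    using Lp_integral_eq_integral_cbox[of p "\<lambda>x. max 0 (w t x)" l r] p outside[OF t]
      subsolution_on_continuous(2)[OF w t]
    by (simp add: E_def max_absorb1 continuous_intros)
  ultimately show ?thesis
    using s T by (simp add: ennreal_leI flip: ennreal_mult')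
qed

end

section \<open>The energy inequality for bounded solutions\<close>

definition bounded_sol ::
    "(real \<Rightarrow> real^'d \<Rightarrow> 'd \<Rightarrow> 'd \<Rightarrow> real) \<Rightarrow> (real \<Rightarrow> real^'d \<Rightarrow> 'd \<Rightarrow> real) \<Rightarrow> (real \<Rightarrow> real^'d \<Rightarrow> real)
      \<Rightarrow> real \<Rightarrow> real \<Rightarrow> (real \<Rightarrow> real^'d \<Rightarrow> real) \<Rightarrow> bool" where
  "bounded_sol Q B c s T u \<longleftrightarrow>
     bounded ((\<lambda>(t, x). u t x) ` ({s..T} \<times> UNIV)) \<and>
     (\<exists>Dt Du D2u. C12_strip_with s T u Dt Du D2u \<and>
        (\<forall>t\<in>{s<..<T}. \<forall>x. Dt t x = Aop Q B c t x (u t x) (\<lambda>i. Du i t x) (\<lambda>i j. D2u i j t x)))"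

definition lyapunov_function ::
    "(real \<Rightarrow> real^'d \<Rightarrow> 'd \<Rightarrow> 'd \<Rightarrow> real) \<Rightarrow> (real \<Rightarrow> real^'d \<Rightarrow> 'd \<Rightarrow> real) \<Rightarrow> (real \<Rightarrow> real^'d \<Rightarrow> real)
      \<Rightarrow> real \<Rightarrow> real \<Rightarrow> real \<Rightarrow> (real^'d \<Rightarrow> real) \<Rightarrow> bool" where
  "lyapunov_function Q B c s T lam \<phi> \<longleftrightarrow>
     0 \<le> lam \<and> (\<forall>x. 0 < \<phi> x) \<and> filterlim \<phi> at_top at_infinity \<and>
     (\<exists>D\<phi> D2\<phi>. C2_with \<phi> D\<phi> D2\<phi> \<and>
        (\<forall>t\<in>{s<..<T}. \<forall>x. Aop Q B c t x (\<phi> x) (\<lambda>i. D\<phi> i x) (\<lambda>i j. D2\<phi> i j x) \<le> lam * \<phi> x))"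

lemma Aop_diff:
  "Aop Q B c t x (u - v) (\<lambda>i. Du i - Dv i) (\<lambda>i j. D2u i j - D2v i j)
    = Aop Q B c t x u Du D2u - Aop Q B c t x v Dv D2v"
  by (simp add: Aop_def algebra_simps sum_subtractf)

lemma Aop_cmult:
  "Aop Q B c t x (k * u) (\<lambda>i. k * Du i) (\<lambda>i j. k * D2u i j) = k * Aop Q B c t x u Du D2u"
  by (simp add: Aop_def algebra_simps sum_distrib_left)

lemma C2_with_diff:
  assumes "C2_with u Du D2u" "C2_with v Dv D2v"
  shows "C2_with (\<lambda>x. u x - v x) (\<lambda>i x. Du i x - Dv i x) (\<lambda>i j x. D2u i j x - D2v i j x)"
  using assms unfolding C2_with_def by (auto intro!: has_partial_diff continuous_on_diff)

lemma C2_with_cmult: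
  assumes "C2_with u Du D2u"
  shows "C2_with (\<lambda>x. k * u x) (\<lambda>i x. k * Du i x) (\<lambda>i j x. k * D2u i j x)"
  using assms unfolding C2_with_def by (auto intro!: has_partial_cmult continuous_on_mult_left)

lemma C12_strip_with_diff:
  assumes "C12_strip_with s T u Dtu Du D2u" "C12_strip_with s T v Dtv Dv D2v"
  shows "C12_strip_with s T (\<lambda>t x. u t x - v t x) (\<lambda>t x. Dtu t x - Dtv t x)
    (\<lambda>i t x. Du i t x - Dv i t x) (\<lambda>i j t x. D2u i j t x - D2v i j t x)"
  using assms unfolding C12_strip_with_def split_beta
  by (auto intro!: continuous_on_diff DERIV_diff C2_with_diff)

lemma C12_strip_with_separated:
  assumes \<phi>: "C2_with \<phi> D\<phi> D2\<phi>" and k: "\<And>t. (k has_real_derivative k' t) (at t)" "continuous_on UNIV k'"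
  shows "C12_strip_with s T (\<lambda>t x. k t * \<phi> x) (\<lambda>t x. k' t * \<phi> x)
    (\<lambda>i t x. k t * D\<phi> i x) (\<lambda>i j t x. k t * D2\<phi> i j x)"
proof -
  have "continuous_on UNIV \<phi>" using \<phi> by (simp add: C2_with_def)
  moreover have "continuous_on UNIV k"
    using k(1) by (auto simp: continuous_on_eq_continuous_at intro: DERIV_isCont)
  ultimately have "continuous_on S (\<lambda>(t, x). k t * \<phi> x)" "continuous_on S (\<lambda>(t, x). k' t * \<phi> x)" for S
    unfolding split_beta
    by (auto intro!: continuous_intros k(2) intro: continuous_on_compose2[OF _ _ subset_UNIV])
  then show ?thesis
    using k(1) unfolding C12_strip_with_def by (auto intro!: C2_with_cmult \<phi> DERIV_cmult_right)
qed

lemma bounded_sol_diff: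
  assumes "bounded_sol Q B c s T u" "bounded_sol Q B c s T v"
  shows "bounded_sol Q B c s T (\<lambda>t x. u t x - v t x)"
proof -
  obtain Dtu Du D2u where u: "C12_strip_with s T u Dtu Du D2u"
      "\<forall>t\<in>{s<..<T}. \<forall>x. Dtu t x = Aop Q B c t x (u t x) (\<lambda>i. Du i t x) (\<lambda>i j. D2u i j t x)"
    using assms(1) unfolding bounded_sol_def by blast
  obtain Dtv Dv D2v where v: "C12_strip_with s T v Dtv Dv D2v"
      "\<forall>t\<in>{s<..<T}. \<forall>x. Dtv t x = Aop Q B c t x (v t x) (\<lambda>i. Dv i t x) (\<lambda>i j. D2v i j t x)"
    using assms(2) unfolding bounded_sol_def by blast
  have "bounded ((\<lambda>z. (case z of (t, x) \<Rightarrow> u t x) - (case z of (t, x) \<Rightarrow> v t x)) ` ({s..T} \<times> UNIV))"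
    using assms by (intro bounded_minus_comp) (auto simp: bounded_sol_def)
  then have "bounded ((\<lambda>(t, x). u t x - v t x) ` ({s..T} \<times> UNIV))" by (simp add: split_beta)
  moreover have "\<forall>t\<in>{s<..<T}. \<forall>x. Dtu t x - Dtv t x
      = Aop Q B c t x (u t x - v t x) (\<lambda>i. Du i t x - Dv i t x) (\<lambda>i j. D2u i j t x - D2v i j t x)"
    using u(2) v(2) by (simp add: Aop_diff)
  ultimately show ?thesis
    using C12_strip_with_diff[OF u(1) v(1)] unfolding bounded_sol_def by blast
qed

lemma bounded_sol_continuous:
  assumes "bounded_sol Q B c s T u" "t \<in> {s..T}"
  shows "continuous_on UNIV (u t)"
  using assms C12_strip_withD(1) continuous_on_slice unfolding bounded_sol_def by blast

lemma subsolution_on_penalized: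
  assumes u: "bounded_sol Q B c s T u" and \<phi>: "lyapunov_function Q B c s T lam \<phi>" and "0 \<le> \<epsilon>"
  shows "subsolution_on Q B c s T (\<lambda>t x. u t x - \<epsilon> * exp (lam * (t - s)) * \<phi> x)"
proof -
  obtain Dt Du D2u where u_C12: "C12_strip_with s T u Dt Du D2u"
    and sol: "\<forall>t\<in>{s<..<T}. \<forall>x. Dt t x = Aop Q B c t x (u t x) (\<lambda>i. Du i t x) (\<lambda>i j. D2u i j t x)"
    using u unfolding bounded_sol_def by blast
  obtain D\<phi> D2\<phi> where \<phi>_C2: "C2_with \<phi> D\<phi> D2\<phi>"
    and lyapunov: "\<And>t x. t \<in> {s<..<T} \<Longrightarrow> Aop Q B c t x (\<phi> x) (\<lambda>i. D\<phi> i x) (\<lambda>i j. D2\<phi> i j x) \<le> lam * \<phi> x"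
    using \<phi> unfolding lyapunov_function_def by blast
  define k where "k t = \<epsilon> * exp (lam * (t - s))" for t
  have "(k has_real_derivative k t * lam) (at t)" for t
    unfolding k_def by (auto intro!: derivative_eq_intros)
  moreover have "continuous_on UNIV (\<lambda>t. k t * lam)"
    unfolding k_def by (intro continuous_intros)
  ultimately have "C12_strip_with s T (\<lambda>t x. u t x - k t * \<phi> x) (\<lambda>t x. Dt t x - k t * lam * \<phi> x)
      (\<lambda>i t x. Du i t x - k t * D\<phi> i x) (\<lambda>i j t x. D2u i j t x - k t * D2\<phi> i j x)"
    by (intro C12_strip_with_diff u_C12 C12_strip_with_separated \<phi>_C2)
  moreover have "Dt t x - k t * lam * \<phi> x \<le> Aop Q B c t x (u t x - k t * \<phi> x)
      (\<lambda>i. Du i t x - k t * D\<phi> i x) (\<lambda>i j. D2u i j t x - k t * D2\<phi> i j x)" if t: "t \<in> {s<..<T}" for t x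
  proof -
    have "k t * Aop Q B c t x (\<phi> x) (\<lambda>i. D\<phi> i x) (\<lambda>i j. D2\<phi> i j x) \<le> k t * (lam * \<phi> x)"
      using \<open>0 \<le> \<epsilon>\<close> by (intro mult_left_mono lyapunov t) (simp add: k_def)
    then show ?thesis using sol t by (simp add: Aop_diff Aop_cmult)
  qed
  ultimately have "subsolution_on Q B c s T (\<lambda>t x. u t x - k t * \<phi> x)"
    unfolding subsolution_on_def by blast
  then show ?thesis by (simp add: k_def)
qed

lemma penalized_nonpos_outside_box:
  fixes u :: "real \<Rightarrow> real^'d \<Rightarrow> real"
  assumes u: "bounded_sol Q B c s T u" and \<phi>: "lyapunov_function Q B c s T lam \<phi>" and \<epsilon>: "0 < \<epsilon>"
  obtains l r where "\<And>t x. t \<in> {s..T} \<Longrightarrow> x \<notin> cbox l r \<Longrightarrow> u t x - \<epsilon> * exp (lam * (t - s)) * \<phi> x \<le> 0"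
proof -
  have "bdd_above ((\<lambda>(t, x). u t x) ` ({s..T} \<times> UNIV))"
    using u by (intro bounded_imp_bdd_above) (simp add: bounded_sol_def)
  then obtain M where M: "\<And>t x. t \<in> {s..T} \<Longrightarrow> u t x \<le> M"
    unfolding bdd_above_def by force
  have "\<forall>\<^sub>F x in at_infinity. M / \<epsilon> \<le> \<phi> x"
    using \<phi> by (simp add: lyapunov_function_def filterlim_at_top)
  then obtain R where R: "\<And>x. R \<le> norm x \<Longrightarrow> M / \<epsilon> \<le> \<phi> x" by (auto simp: eventually_at_infinity)
  obtain m where m: "cball 0 R \<subseteq> cbox (- m) (m :: real^'d)"
    using bounded_subset_cbox_symmetric[of "cball 0 R"] by auto
  have "u t x - \<epsilon> * exp (lam * (t - s)) * \<phi> x \<le> 0" if t: "t \<in> {s..T}" and x: "x \<notin> cbox (- m) m" for t x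
  proof -
    have "M \<le> \<epsilon> * \<phi> x" using R[of x] m x \<epsilon> by (fastforce simp: field_simps subset_iff)
    also have "\<dots> = \<epsilon> * 1 * \<phi> x" by simp
    also have "\<dots> \<le> \<epsilon> * exp (lam * (t - s)) * \<phi> x"
      using \<epsilon> t \<phi> by (intro mult_right_mono mult_left_mono) (auto simp: lyapunov_function_def less_imp_le)
    finally show ?thesis using M[OF t, of x] by simp
  qed
  then show thesis by (rule that)
qed

context dissipative_coefficients
begin

lemma sol_energy_le:
  assumes u: "bounded_sol Q B c s T u" and \<phi>: "lyapunov_function Q B c s T lam \<phi>"
  shows "Lp_integral p (\<lambda>x. max 0 (u T x))
    \<le> ennreal (exp (p * K * (T - s))) * Lp_integral p (\<lambda>x. max 0 (u s x))"
proof -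
  define w where "w \<epsilon> t x = u t x - \<epsilon> * exp (lam * (t - s)) * \<phi> x" for \<epsilon> t x
  define \<epsilon> where "\<epsilon> n = inverse (real (Suc n))" for n
  have w_sub: "subsolution_on Q B c s T (w (\<epsilon> n))" for n
    unfolding w_def[abs_def] by (rule subsolution_on_penalized[OF u \<phi>]) (simp add: \<epsilon>_def)
  show ?thesis
  proof (rule Lp_integral_Fatou[OF _ _ _ _ tendsto_const])
    have "continuous_on UNIV (w (\<epsilon> n) T)" for n
      using subsolution_on_continuous(2)[OF w_sub] s_less_T by simp
    then show "(\<lambda>x. max 0 (w (\<epsilon> n) T x)) \<in> borel_measurable lebesgue" for n
      by (intro borel_measurable_lebesgue_continuous continuous_intros)
    have "(\<lambda>n. max 0 (w (\<epsilon> n) T x)) \<longlonglongrightarrow> max 0 (u T x - 0 * exp (lam * (T - s)) * \<phi> x)" for x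
      unfolding w_def \<epsilon>_def by (intro tendsto_intros LIMSEQ_inverse_real_of_nat)
    then show "AE x in lebesgue. (\<lambda>n. max 0 (w (\<epsilon> n) T x)) \<longlonglongrightarrow> max 0 (u T x)" by simp
    fix n
    have "0 < \<epsilon> n" by (simp add: \<epsilon>_def)
    from penalized_nonpos_outside_box[OF u \<phi> this]
    obtain l r where "\<And>t x. t \<in> {s..T} \<Longrightarrow> x \<notin> cbox l r \<Longrightarrow> w (\<epsilon> n) t x \<le> 0"
      unfolding w_def by blast
    then have "Lp_integral p (\<lambda>x. max 0 (w (\<epsilon> n) T x))
        \<le> ennreal (exp (p * K * (T - s))) * Lp_integral p (\<lambda>x. max 0 (w (\<epsilon> n) s x))"
      by (rule subsolution_energy_le[OF w_sub])
    also have "Lp_integral p (\<lambda>x. max 0 (w (\<epsilon> n) s x)) \<le> Lp_integral p (\<lambda>x. max 0 (u s x))"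
    proof (rule Lp_integral_mono)
      fix x
      have "w (\<epsilon> n) s x \<le> u s x"
        using \<phi> by (simp add: w_def \<epsilon>_def lyapunov_function_def less_imp_le)
      then show "\<bar>max 0 (w (\<epsilon> n) s x)\<bar> \<le> \<bar>max 0 (u s x)\<bar>" by simp
    qed (use p in simp)
    finally show "Lp_integral p (\<lambda>x. max 0 (w (\<epsilon> n) T x))
        \<le> ennreal (exp (p * K * (T - s))) * Lp_integral p (\<lambda>x. max 0 (u s x))"
      by (simp add: mult_left_mono)
  qed (use p in simp)
qed

lemma bounded_sol_unique:
  assumes "bounded_sol Q B c s T u" "bounded_sol Q B c s T v" "u s = v s"
    and \<phi>: "lyapunov_function Q B c s T lam \<phi>"
  shows "u T = v T"
proof -
  have le: "u T x \<le> v T x" if "bounded_sol Q B c s T u" "bounded_sol Q B c s T v" "u s = v s" for u v x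
  proof -
    note diff = bounded_sol_diff[OF that(1,2)]
    have "Lp_integral p (\<lambda>x. max 0 (u T x - v T x)) = 0"
      using sol_energy_le[OF diff \<phi>] that(3) by (simp add: Lp_integral_def)
    moreover have "continuous_on UNIV (\<lambda>x. max 0 (u T x - v T x))"
      using bounded_sol_continuous[OF diff, of T] s_less_T by (intro continuous_on_max continuous_on_const) simp
    ultimately show ?thesis
      using Lp_integral_eq_0_imp_eq_0[of "\<lambda>x. max 0 (u T x - v T x)" p x] by simp
  qed
  show ?thesis
    using le[OF assms(1,2,3)] le[OF assms(2,1) assms(3)[symmetric]] by (intro ext order.antisym)
qed

end

section \<open>The Cauchy problem and the Green function\<close>

lemma holder_loc_continuous_on_compact:
  assumes "holder_loc \<alpha> S F" "0 < \<alpha>" "compact K" "K \<subseteq> S"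
  shows "continuous_on K (\<lambda>(t, x). F t x)"
proof -
  obtain C where C: "\<forall>t x s y. (t, x) \<in> K \<and> (s, y) \<in> K \<longrightarrow>
      \<bar>F t x - F s y\<bar> \<le> C * (\<bar>t - s\<bar> powr (\<alpha>/2) + dist x y powr \<alpha>)"
    using assms(1)[unfolded holder_loc_def, rule_format, OF conjI[OF assms(3,4)]] ..
  have "((\<lambda>z. case z of (t, x) \<Rightarrow> F t x) \<longlongrightarrow> F s y) (at (s, y) within K)" if "(s, y) \<in> K" for s y
  proof (rule LIM_zero_cancel, rule Lim_null_comparison)
    let ?modulus = "\<lambda>z. C * (\<bar>fst z - s\<bar> powr (\<alpha>/2) + dist (snd z) y powr \<alpha>)"
    show "\<forall>\<^sub>F z in at (s, y) within K. norm ((case z of (t, x) \<Rightarrow> F t x) - F s y) \<le> ?modulus z"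
      using C that by (auto simp: eventually_at_filter intro!: always_eventually)
    have "(?modulus \<longlongrightarrow> ?modulus (s, y)) (at (s, y) within K)"
      using \<open>0 < \<alpha>\<close> by (intro tendsto_intros tendsto_powr') auto
    then show "(?modulus \<longlongrightarrow> 0) (at (s, y) within K)" by simp
  qed
  then show ?thesis unfolding continuous_on_def by auto
qed

lemma holder_loc_continuous_on_open:
  assumes "holder_loc \<alpha> S F" "0 < \<alpha>" "open S"
  shows "continuous_on S (\<lambda>(t, x). F t x)"
  unfolding continuous_on_eq_continuous_at[OF assms(3)]
proof
  fix z assume "z \<in> S"
  then obtain r where r: "0 < r" "cball z r \<subseteq> S" using assms(3) open_contains_cball by blast
  then have "continuous_on (cball z r) (\<lambda>(t, x). F t x)"
    by (intro holder_loc_continuous_on_compact[OF assms(1,2)]) auto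
  then show "isCont (\<lambda>(t, x). F t x) z"
    using r by (intro continuous_on_interior[of "cball z r"]) (auto simp: interior_cball)
qed

lemma holder_loc_continuous_on_slice:
  assumes "holder_loc \<alpha> (I \<times> UNIV) F" "0 < \<alpha>" "t \<in> I"
  shows "continuous_on UNIV (F t)"
  unfolding continuous_on_eq_continuous_at[OF open_UNIV]
proof
  fix x
  have "continuous_on ({t} \<times> cball x 1) (\<lambda>(t, x). F t x)"
    using assms(3) by (intro holder_loc_continuous_on_compact[OF assms(1,2)] compact_Times) auto
  then have "continuous_on (cball x 1) (F t)" by (rule continuous_on_slice) simp
  then show "isCont (F t) x"
    by (intro continuous_on_interior[of "cball x 1"]) (auto simp: interior_cball)
qed

lemma holder_loc_cmult:
  assumes "holder_loc \<alpha> S F"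
  shows "holder_loc \<alpha> S (\<lambda>t x. k * F t x)"
  unfolding holder_loc_def
proof (intro allI impI)
  fix A assume "compact A \<and> A \<subseteq> S"
  then obtain C where C: "\<And>t x s y. (t, x) \<in> A \<and> (s, y) \<in> A \<Longrightarrow>
      \<bar>F t x - F s y\<bar> \<le> C * (\<bar>t - s\<bar> powr (\<alpha>/2) + dist x y powr \<alpha>)"
    using assms[unfolded holder_loc_def, rule_format, of A] by auto
  show "\<exists>C. \<forall>t x s y. (t, x) \<in> A \<and> (s, y) \<in> A \<longrightarrow>
      \<bar>k * F t x - k * F s y\<bar> \<le> C * (\<bar>t - s\<bar> powr (\<alpha>/2) + dist x y powr \<alpha>)"
  proof (intro exI[of _ "\<bar>k\<bar> * C"] allI impI)
    fix t x s y assume "(t, x) \<in> A \<and> (s, y) \<in> A"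
    from mult_left_mono[OF C[OF this], of "\<bar>k\<bar>"]
    show "\<bar>k * F t x - k * F s y\<bar> \<le> \<bar>k\<bar> * C * (\<bar>t - s\<bar> powr (\<alpha>/2) + dist x y powr \<alpha>)"
      by (simp add: abs_mult[symmetric] right_diff_distrib mult.assoc)
  qed
qed

lemma cauchy_sol_imp_bounded_sol:
  fixes u :: "real \<Rightarrow> real^'d \<Rightarrow> real"
  assumes u: "cauchy_sol \<alpha> Q B c s f u" and "0 < \<alpha>" "s < T"
  shows "bounded_sol Q B c s T u"
proof -
  obtain Dt Du D2u where C12: "C12_holder_loc_with \<alpha> ({s<..} \<times> UNIV) u Dt Du D2u"
    and pde: "\<And>t x. t > s \<Longrightarrow> Dt t x = Aop Q B c t x (u t x) (\<lambda>i. Du i t x) (\<lambda>i j. D2u i j t x)"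
    using u unfolding cauchy_sol_def by blast
  have slice: "continuous_on UNIV (F t)" if "holder_loc \<alpha> ({s<..} \<times> UNIV) F" "s < t"
    for t and F :: "real \<Rightarrow> real^'d \<Rightarrow> real"
    using holder_loc_continuous_on_slice[OF that(1) \<open>0 < \<alpha>\<close>] that(2) by simp
  have "C12_strip_with s T u Dt Du D2u"
    unfolding C12_strip_with_def
  proof (intro conjI ballI allI)
    show "continuous_on ({s..T} \<times> UNIV) (\<lambda>(t, x). u t x)"
      using u unfolding cauchy_sol_def by (elim conjE, elim continuous_on_subset) auto
    have "open ({s<..} \<times> (UNIV :: (real^'d) set))" by (intro open_Times) auto
    moreover have "holder_loc \<alpha> ({s<..} \<times> UNIV) Dt" using C12 by (simp add: C12_holder_loc_with_def)
    ultimately show "continuous_on ({s<..<T} \<times> UNIV) (\<lambda>(t, x). Dt t x)"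
      using \<open>0 < \<alpha>\<close> by (intro continuous_on_subset[OF holder_loc_continuous_on_open]) auto
    fix t assume "t \<in> {s<..<T}"
    then show "((\<lambda>\<tau>. u \<tau> x) has_real_derivative Dt t x) (at t)" for x
      using C12 by (auto simp: C12_holder_loc_with_def)
    show "C2_with (u t) (\<lambda>i. Du i t) (\<lambda>i j. D2u i j t)"
      using C12 \<open>t \<in> {s<..<T}\<close> unfolding C2_with_def C12_holder_loc_with_def by (auto intro!: slice)
  qed
  then show ?thesis
    using u pde \<open>s < T\<close> unfolding cauchy_sol_def bounded_sol_def by (meson greaterThanLessThan_iff)
qed

lemma cauchy_sol_zero: "cauchy_sol \<alpha> Q B c s (\<lambda>_. 0) (\<lambda>_ _. 0)"
proof -
  have "holder_loc \<alpha> S (\<lambda>_ _. 0)" for S :: "(real \<times> (real^'d)) set"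
    unfolding holder_loc_def by (intro allI impI exI[of _ 0]) simp
  then have "C12_holder_loc_with \<alpha> ({s<..} \<times> (UNIV :: (real^'d) set))
      (\<lambda>_ _. 0) (\<lambda>_ _. 0) (\<lambda>_ _ _. 0) (\<lambda>_ _ _ _. 0)"
    by (auto simp: C12_holder_loc_with_def has_partial_def)
  moreover have "Aop Q B c t x 0 (\<lambda>_. 0) (\<lambda>_ _. 0) = 0" for t x
    by (simp add: Aop_def)
  moreover have "bounded ((\<lambda>(t, x). 0 :: real) ` S)" for S :: "(real \<times> (real^'d)) set"
    by (auto simp: bounded_iff)
  ultimately show ?thesis
    unfolding cauchy_sol_def split_beta by (intro conjI allI exI) auto
qed

lemma cauchy_sol_cmult:
  assumes "cauchy_sol \<alpha> Q B c s f u"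
  shows "cauchy_sol \<alpha> Q B c s (\<lambda>x. k * f x) (\<lambda>t x. k * u t x)"
proof -
  obtain Dt Du D2u where u: "C12_holder_loc_with \<alpha> ({s<..} \<times> UNIV) u Dt Du D2u"
    and pde: "\<And>t x. t > s \<Longrightarrow> Dt t x = Aop Q B c t x (u t x) (\<lambda>i. Du i t x) (\<lambda>i j. D2u i j t x)"
    using assms(1) unfolding cauchy_sol_def by blast
  have "C12_holder_loc_with \<alpha> ({s<..} \<times> UNIV) (\<lambda>t x. k * u t x) (\<lambda>t x. k * Dt t x)
      (\<lambda>i t x. k * Du i t x) (\<lambda>i j t x. k * D2u i j t x)"
    using u unfolding C12_holder_loc_with_def
    by (auto intro!: holder_loc_cmult has_partial_cmult DERIV_cmult)
  moreover have "k * Dt t x = Aop Q B c t x (k * u t x) (\<lambda>i. k * Du i t x) (\<lambda>i j. k * D2u i j t x)"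
    if "t > s" for t x
    by (simp add: pde[OF that] Aop_cmult)
  moreover have "continuous_on ({s..} \<times> UNIV) (\<lambda>(t, x). k * u t x)"
    using assms unfolding cauchy_sol_def split_beta by (intro continuous_on_mult_left) auto
  moreover have "bounded ((\<lambda>(t, x). k * u t x) ` ({s..T} \<times> UNIV))" if "T > s" for T
  proof -
    have "bounded ((\<lambda>z. k *\<^sub>R z) ` (\<lambda>(t, x). u t x) ` ({s..T} \<times> UNIV))"
      using assms that unfolding cauchy_sol_def by (intro bounded_scaling) blast
    then show ?thesis by (simp add: image_image split_beta)
  qed
  moreover have "k * u s x = k * f x" for x using assms unfolding cauchy_sol_def by simp
  ultimately show ?thesis unfolding cauchy_sol_def by blast
qed

lemma Cb_cmult: "f \<in> Cb \<Longrightarrow> (\<lambda>x. k * f x) \<in> Cb"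
  using bounded_scaling[of "range f" k] by (auto simp: Cb_def image_image intro!: continuous_intros)

lemma green_funD:
  assumes "green_fun \<alpha> I Q B c g" "s \<in> I" "s < t"
  shows "0 < g t s x y"
    and "f \<in> Cb \<Longrightarrow> integrable lebesgue (\<lambda>y. g t s x y * f y)"
    and "f \<in> Cb \<Longrightarrow> evol \<alpha> Q B c t s f = kernel_op (g t s) f"
  using assms by (auto simp: green_fun_def kernel_op_def)

lemma evol_eq_cauchy_sol:
  assumes "cauchy_sol \<alpha> Q B c s f u" "s < t"
    and "\<And>v. cauchy_sol \<alpha> Q B c s f v \<Longrightarrow> v t = u t"
  shows "evol \<alpha> Q B c t s f = u t"
proof -
  have "(THE v. \<exists>u. cauchy_sol \<alpha> Q B c s f u \<and> v = u t) = u t"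
    by (rule the_equality) (use assms in blast)+
  then show ?thesis using assms(2) by (simp add: evol_def)
qed

text \<open>If the Cauchy problem had no solution for \<open>f\<close>, it would have none for \<open>2 f\<close> either, and \<open>evol\<close>
  would return the same junk value for both;
  linearity of the integral would make that value \<open>0\<close>, whereas \<open>g > 0\<close>.\<close>

lemma green_fun_imp_cauchy_solvable:
  assumes green: "green_fun \<alpha> I Q B c g" "s \<in> I" and f: "f \<in> Cb" "\<And>x. 0 \<le> f x"
  shows "\<exists>u. cauchy_sol \<alpha> Q B c s f u"
proof (rule ccontr)
  assume unsolvable: "\<nexists>u. cauchy_sol \<alpha> Q B c s f u"
  define t where "t = s + 1"
  then have "s < t" by simp
  note g = green_funD[OF green \<open>s < t\<close>]
  have "\<nexists>u. cauchy_sol \<alpha> Q B c s (\<lambda>x. 2 * f x) u"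
    using unsolvable cauchy_sol_cmult[of \<alpha> Q B c s "\<lambda>x. 2 * f x" _ "1/2"] by auto
  then have "evol \<alpha> Q B c t s (\<lambda>x. 2 * f x) = evol \<alpha> Q B c t s f"
    unfolding evol_def using unsolvable \<open>s < t\<close> by simp
  then have "kernel_op (g t s) (\<lambda>x. 2 * f x) 0 = kernel_op (g t s) f 0"
    using g(3) f(1) Cb_cmult by metis
  moreover have "kernel_op (g t s) (\<lambda>x. 2 * f x) 0 = 2 * kernel_op (g t s) f 0"
    using integral_mult_right_zero[of lebesgue 2 "\<lambda>y. g t s 0 y * f y"]
    by (simp add: kernel_op_def mult.left_commute)
  ultimately have "(LINT y|lebesgue. g t s 0 y * f y) = 0" by (simp add: kernel_op_def)
  moreover have "0 \<le> g t s 0 y * f y" for y using g(1) f(2) by (simp add: less_imp_le)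
  ultimately have "AE y in lebesgue. g t s 0 y * f y = 0"
    using integral_nonneg_eq_0_iff_AE[OF g(2)[OF f(1)]] by auto
  then have "AE y in lebesgue. f y = 0"
    by eventually_elim (use g(1) in \<open>simp add: less_imp_neq[symmetric]\<close>)
  then have "f = (\<lambda>_. 0)" using f(1) continuous_AE_eq_0_imp_eq_0 by (auto simp: Cb_def)
  then show False using unsolvable cauchy_sol_zero by blast
qed

context dissipative_coefficients
begin

lemma Lp_bounded_at_green:
  assumes green: "green_fun \<alpha> I Q B c g" "s \<in> I" and \<alpha>: "0 < \<alpha>"
    and \<phi>: "lyapunov_function Q B c s T lam \<phi>" and h: "h \<in> Cb" "\<And>y. 0 \<le> h y"
  shows "Lp_bounded_at p (exp (p * K * (T - s))) (g T s) h"
proof -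
  note g = green_funD[OF green s_less_T]
  obtain u where u: "cauchy_sol \<alpha> Q B c s h u"
    using green_fun_imp_cauchy_solvable[OF green h] by blast
  have sol: "bounded_sol Q B c s T u" by (rule cauchy_sol_imp_bounded_sol[OF u \<alpha> s_less_T])
  have u_s: "u s = h" using u by (simp add: cauchy_sol_def fun_eq_iff)
  have "v T = u T" if "cauchy_sol \<alpha> Q B c s h v" for v
    using cauchy_sol_imp_bounded_sol[OF that \<alpha> s_less_T] sol
    by (rule bounded_sol_unique[OF _ _ _ \<phi>]) (use that u in \<open>auto simp: cauchy_sol_def fun_eq_iff\<close>)
  then have u_T: "u T = kernel_op (g T s) h"
    using evol_eq_cauchy_sol[OF u s_less_T] g(3)[OF h(1)] by simp
  have "0 \<le> kernel_op (g T s) h x" for x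
    unfolding kernel_op_def
    by (intro integral_nonneg_AE always_eventually allI mult_nonneg_nonneg h(2) less_imp_le[OF g(1)])
  then have "Lp_integral p (kernel_op (g T s) h) \<le> ennreal (exp (p * K * (T - s))) * Lp_integral p h"
    using sol_energy_le[OF sol \<phi>] h(2) by (simp add: u_T u_s)
  moreover have "continuous_on UNIV (kernel_op (g T s) h)"
    using bounded_sol_continuous[OF sol, of T] s_less_T by (simp add: u_T)
  ultimately show ?thesis
    by (simp add: Lp_bounded_at_def borel_measurable_lebesgue_continuous)
qed

lemma positive_kernel_green:
  assumes green: "green_fun \<alpha> I Q B c g" "s \<in> I" and \<alpha>: "0 < \<alpha>"
    and \<phi>: "lyapunov_function Q B c s T lam \<phi>"
  shows "positive_kernel p (exp (p * K * (T - s))) (g T s)"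
proof
  note g = green_funD[OF green s_less_T]
  show "0 \<le> g T s x y" for x y using g(1) by (simp add: less_imp_le)
  show "integrable lebesgue (g T s x)" for x
    using g(2)[of "\<lambda>_. 1" x] by (simp add: Cb_def)
  show "Lp_bounded_at p (exp (p * K * (T - s))) (g T s) h"
    if "continuous_on UNIV h" "bounded (range h)" "\<And>y. 0 \<le> h y" for h
    using that by (intro Lp_bounded_at_green[OF green \<alpha> \<phi>]) (simp_all add: Cb_def)
qed (use p in simp)

end

section \<open>Invariance of \<open>L\<^sup>p\<close>\<close>

lemma standing_assms_interval_subset:
  assumes "standing_assms \<alpha> I Q B c \<eta>" "a \<in> I" "b \<in> I"
  shows "{a..b} \<subseteq> I"
  using assms unfolding standing_assms_def by auto

lemma standing_assms_imp_dissipative: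
  assumes std: "standing_assms \<alpha> I Q B c \<eta>" and J: "{s..t} \<subseteq> J" "J \<subseteq> I"
    and "1 < p" "0 \<le> K" "s < t"
    and DQ: "\<forall>t\<in>J. \<forall>x i j k. has_partial (\<lambda>y. Q t y i j) k x (DQ k i j t x)"
      "\<forall>i j k. continuous_on (J \<times> UNIV) (\<lambda>(t, x). DQ k i j t x)"
    and bound: "\<forall>t\<in>J. \<forall>x.
        (\<Sum>i\<in>UNIV. (B t x i - (\<Sum>j\<in>UNIV. DQ j i j t x))\<^sup>2) / (4 * (p - 1) * \<eta> t x) - c t x \<le> K"
  shows "dissipative_coefficients p K s t Q B c \<eta> DQ"
proof
  fix \<tau> x assume "\<tau> \<in> {s<..<t}"
  then have "\<tau> \<in> {s..t}" by simp
  then have \<tau>: "\<tau> \<in> J" "\<tau> \<in> I" using J by blast+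
  show "Q \<tau> x i j = Q \<tau> x j i" for i j
    using std \<tau> by (simp add: standing_assms_def)
  show "continuous_on UNIV (\<lambda>x. Q \<tau> x i j)" for i j
    using std \<tau>
    by (intro holder_loc_continuous_on_slice[of \<alpha> I "\<lambda>t x. Q t x i j"]) (auto simp: standing_assms_def)
  show "has_partial (\<lambda>y. Q \<tau> y i j) k x (DQ k i j \<tau> x)" for i j k
    using DQ(1) \<tau> by blast
  show "continuous_on UNIV (DQ k i j \<tau>)" for i j k
    using DQ(2) \<tau> by (blast intro: continuous_on_slice)
  have "\<exists>\<eta>0>0. \<forall>t\<in>I. \<forall>x. \<eta>0 \<le> \<eta> t x" using std by (simp add: standing_assms_def)
  then show "0 < \<eta> \<tau> x" using \<tau> by (meson less_le_trans)
  show "\<eta> \<tau> x * (norm \<xi>)\<^sup>2 \<le> (\<Sum>i\<in>UNIV. \<Sum>j\<in>UNIV. Q \<tau> x i j * \<xi>$i * \<xi>$j)" for \<xi>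
    using std \<tau> by (simp add: standing_assms_def)
  show "(\<Sum>i\<in>UNIV. (B \<tau> x i - (\<Sum>j\<in>UNIV. DQ j i j \<tau> x))\<^sup>2) / (4 * (p - 1) * \<eta> \<tau> x) - c \<tau> x \<le> K"
    using bound \<tau> by blast
qed (use assms in auto)

lemma standing_assms_imp_lyapunov_function:
  assumes std: "standing_assms \<alpha> I Q B c \<eta>" and "{s..t} \<subseteq> I"
  obtains lam \<phi> where "lyapunov_function Q B c s t lam \<phi>"
proof -
  have "is_interval {s..t} \<and> bounded {s..t} \<and> {s..t} \<subseteq> I"
    using assms(2) by (simp add: is_interval_cc)
  then obtain \<phi> D\<phi> D2\<phi> lam where C2: "C2_with \<phi> D\<phi> D2\<phi>"
    and \<phi>: "\<forall>x. 0 < \<phi> x" "filterlim \<phi> at_top at_infinity"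
    and le: "\<forall>\<tau>\<in>{s..t}. \<forall>x. Aop Q B c \<tau> x (\<phi> x) (\<lambda>i. D\<phi> i x) (\<lambda>i j. D2\<phi> i j x) \<le> lam * \<phi> x"
    using std unfolding standing_assms_def by meson
  have "lam * \<phi> x \<le> max 0 lam * \<phi> x" for x
    using \<phi>(1) by (intro mult_right_mono) (auto simp: less_imp_le)
  then have "\<forall>\<tau>\<in>{s<..<t}. \<forall>x. Aop Q B c \<tau> x (\<phi> x) (\<lambda>i. D\<phi> i x) (\<lambda>i j. D2\<phi> i j x) \<le> max 0 lam * \<phi> x"
    using le by (meson greaterThanLessThan_subseteq_atLeastAtMost_iff order.refl order.trans subsetD)
  then have "lyapunov_function Q B c s t (max 0 lam) \<phi>"
    using C2 \<phi> unfolding lyapunov_function_def by auto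
  then show thesis by (rule that)
qed

theorem theorem5p4:
  fixes \<alpha> p a b K :: real and I :: "real set"
    and Q :: "real \<Rightarrow> real^'d \<Rightarrow> 'd \<Rightarrow> 'd \<Rightarrow> real"
    and B :: "real \<Rightarrow> real^'d \<Rightarrow> 'd \<Rightarrow> real"
    and c \<eta> :: "real \<Rightarrow> real^'d \<Rightarrow> real"
    and g :: "real \<Rightarrow> real \<Rightarrow> real^'d \<Rightarrow> real^'d \<Rightarrow> real"
    and DQ :: "'d \<Rightarrow> 'd \<Rightarrow> 'd \<Rightarrow> real \<Rightarrow> real^'d \<Rightarrow> real"
    and f :: "real^'d \<Rightarrow> real"
  assumes std: "standing_assms \<alpha> I Q B c \<eta>"
    and green: "green_fun \<alpha> I Q B c g"
    and p: "1 < p"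
    and ab: "a \<in> I" "b \<in> I" "a < b"
    and DQ_deriv: "\<forall>t\<in>{a..b}. \<forall>x i j k. has_partial (\<lambda>y. Q t y i j) k x (DQ k i j t x)"
    and DQ_cont: "\<forall>i j k. continuous_on ({a..b} \<times> UNIV) (\<lambda>(t, x). DQ k i j t x)"
    and K: "0 < K"
    and Kbound: "\<forall>t\<in>{a..b}. \<forall>x.
        (\<Sum>i\<in>UNIV. (B t x i - (\<Sum>j\<in>UNIV. DQ j i j t x))\<^sup>2) / (4 * (p - 1) * \<eta> t x) - c t x \<le> K"
    and st: "a \<le> s" "s \<le> t" "t \<le> b"
    and f: "in_Lp p f"
  shows "(s < t \<longrightarrow> (AE x in lebesgue. integrable lebesgue (\<lambda>y. g t s x y * f y)))
    \<and> in_Lp p (green_apply g t s f)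
    \<and> Lp_norm p (green_apply g t s f) \<le> exp (K * (t - s)) * Lp_norm p f"
proof (cases "s = t")
  case True
  then show ?thesis using f by (simp add: green_apply_def[abs_def])
next
  case False
  with st have "s < t" by simp
  have J: "{s..t} \<subseteq> {a..b}" "{a..b} \<subseteq> I"
    using st standing_assms_interval_subset[OF std ab(1,2)] by auto
  then have "s \<in> I" "{s..t} \<subseteq> I" using \<open>s < t\<close> by auto
  have "0 < \<alpha>" using std by (simp add: standing_assms_def)
  obtain lam \<phi> where \<phi>: "lyapunov_function Q B c s t lam \<phi>"
    using standing_assms_imp_lyapunov_function[OF std \<open>{s..t} \<subseteq> I\<close>] by blast
  interpret dissipative_coefficients p K s t Q B c \<eta> DQ
    using K by (intro standing_assms_imp_dissipative[OF std J p _ \<open>s < t\<close> DQ_deriv DQ_cont Kbound]) simp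
  interpret green: positive_kernel p "exp (p * K * (t - s))" "g t s"
    by (rule positive_kernel_green[OF green \<open>s \<in> I\<close> \<open>0 < \<alpha>\<close> \<phi>])
  have apply_eq: "green_apply g t s f = kernel_op (g t s) f"
    using \<open>s < t\<close> by (auto simp: green_apply_def kernel_op_def)
  have f': "f \<in> borel_measurable lebesgue" "Lp_integral p f < \<infinity>" using f by (simp_all add: in_Lp_iff)
  have "exp (p * K * (t - s)) powr (1 / p) = exp (K * (t - s))" using p by (simp add: powr_def)
  then have "in_Lp p (kernel_op (g t s) f)"
      "Lp_norm p (kernel_op (g t s) f) \<le> exp (K * (t - s)) * Lp_norm p f"
    using Lp_bounded_at_imp_Lp_norm_le[OF green.p _ green.Lp_bounded_at_Lp(2)[OF f'] f] by simp_all
  then show ?thesis using green.Lp_bounded_at_Lp(1)[OF f'] by (simp add: apply_eq)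
qed

end
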